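(* Let $X$ be a path-connected space, $x_0\in X$, and $H\leq\pi_1(X,x_0)$ a subgroup. If $X$ is homotopically Hausdorff relative to $H$, then $H$ is $(C,c_{\infty})$-closed. The converse holds if $X$ is first countable (for instance, if $X$ is metrizable): in that case, if $H$ is $(C,c_\infty)$-closed, then $X$ is homotopically Hausdorff relative to $H$.
   Context: A map is a continuous function; $f_{\#}$ denotes the homomorphism induced on fundamental groups. For paths, $\alpha\cdot\beta$ is concatenation and $\alpha^{-}(t)=\alpha(1-t)$. $X$ is homotopically Hausdorff relative to $H\leq\pi_1(X,x_0)$ if for every $x\in X$, every path $\alpha$ from $x_0$ to $x$, and every $g\in\pi_1(X,x)\setminus H^{\alpha}$, where $H^{\alpha}=[\alpha^{-}]H[\alpha]\leq\pi_1(X,x)$, there is an open neighborhood $U$ of $x$ such that there is no loop $\delta$ in $U$ based at $x$ with $H^{\alpha}g=H^{\alpha}[\delta]$. Closed subgroups: for a based space $(\mathbb{T},t_0)$, a subgroup $T\leq\pi_1(\mathbb{T},t_0)$ and $g\in\pi_1(\mathbb{T},t_0)$, a subgroup $H\leq\pi_1(X,x_0)$ is $(T,g)$-closed if for every map $f:(\mathbb{T},t_0)\to(X,x_0)$ with $f_{\#}(T)\leq H$ we have $f_{\#}(g)\in H$. The test space $\mathbb{H}^+$: let $C_n\subseteq\mathbb{R}^2$ be the circle of radius $\frac1n$ centered at $(\frac1n,0)$, $\mathbb{H}=\bigcup_{n\geq1}C_n$ (the Hawaiian earring), $b_0=(0,0)$, and $\mathbb{H}^+=\mathbb{H}\cup([-1,0]\times\{0\})$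 with basepoint $b_0^+=(-1,0)$. Let $\ell_n$ be the loop based at $b_0$ traversing $C_n$ once counterclockwise, and $\ell_\infty:[0,1]\to\mathbb{H}$ the loop that is $\ell_n$ (linearly reparametrized) on $[\frac{n-1}{n},\frac{n}{n+1}]$ for each $n\ge 1$, with $\ell_\infty(1)=b_0$. Let $\iota:[0,1]\to\mathbb{H}^+$, $\iota(t)=(t-1,0)$. Put $c_n=[\iota\cdot\ell_n\cdot\iota^{-}]$, $C=\langle c_n\mid n\in\mathbb{N}\rangle\leq\pi_1(\mathbb{H}^+,b_0^+)$, and $c_\infty=[\iota\cdot\ell_\infty\cdot\iota^{-}]$. *)

theory Defs
  imports "HOL-Analysis.Analysis" "HOL-Algebra.Coset" "HOL-Algebra.Generated_Groups"
begin

text \<open>Spaces are sets \<open>X :: 'a::topological_space set\<close> with the subspace topology (any space is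
  the case \<open>X = UNIV\<close>). A path is a function on \<open>real\<close> of which only the restriction to the unit
  interval matters, so a class contains all extensions of its members to \<open>real\<close>.\<close>

section \<open>Fundamental group\<close>

definition paths_between :: "'a::topological_space set \<Rightarrow> 'a \<Rightarrow> 'a \<Rightarrow> (real \<Rightarrow> 'a) set" where
  "paths_between X x y =
     {p. path p \<and> path_image p \<subseteq> X \<and> pathstart p = x \<and> pathfinish p = y}"

definition path_class :: "'a::topological_space set \<Rightarrow> (real \<Rightarrow> 'a) \<Rightarrow> (real \<Rightarrow> 'a) set" where
  "path_class X p = {q. homotopic_paths X p q}"

text \<open>Defined for arbitrary sets of paths, so that it is also the product of composable classes of
  paths with different end points.\<close>

definition class_mult ::
  "'a::topological_space set \<Rightarrow> (real \<Rightarrow> 'a) set \<Rightarrow> (real \<Rightarrow> 'a) set \<Rightarrow> (real \<Rightarrow> 'a) set" where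
  "class_mult X a b = (\<Union>p\<in>a. \<Union>q\<in>b. path_class X (p +++ q))"

definition fundamental_group :: "'a::topological_space set \<Rightarrow> 'a \<Rightarrow> (real \<Rightarrow> 'a) set monoid" where
  "fundamental_group X x =
     \<lparr>carrier = path_class X ` paths_between X x x,
      mult = class_mult X,
      one = path_class X (\<lambda>t. x)\<rparr>"

text \<open>The homomorphism induced by a map into \<open>Y\<close>.\<close>

definition induced_hom ::
  "'b::topological_space set \<Rightarrow> ('a::topological_space \<Rightarrow> 'b) \<Rightarrow> (real \<Rightarrow> 'a) set \<Rightarrow> (real \<Rightarrow> 'b) set" where
  "induced_hom Y f a = (\<Union>p\<in>a. path_class Y (f \<circ> p))"

lemma path_class_eq:
  assumes "homotopic_paths X p q"
  shows "path_class X p = path_class X q"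
  unfolding path_class_def
  using assms by (blast intro: homotopic_paths_trans homotopic_paths_sym)

lemma path_in_path_class: "p \<in> paths_between X x y \<Longrightarrow> p \<in> path_class X p"
  by (simp add: path_class_def paths_between_def)

lemma class_mult_path_class:
  assumes p: "p \<in> paths_between X x y" and q: "q \<in> paths_between X y z"
  shows "class_mult X (path_class X p) (path_class X q) = path_class X (p +++ q)"
proof -
  have "path_class X (p' +++ q') = path_class X (p +++ q)"
    if "p' \<in> path_class X p" "q' \<in> path_class X q" for p' q'
    using p q that
    by (intro path_class_eq[symmetric] homotopic_paths_join) (simp_all add: paths_between_def path_class_def)
  then show ?thesis
    unfolding class_mult_def using path_in_path_class[OF p] path_in_path_class[OF q] by blast
qed

lemma induced_hom_path_class:
  assumes f: "continuous_on S f" "f ` S \<subseteq> Y" and p: "p \<in> paths_between S x y"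
  shows "induced_hom Y f (path_class S p) = path_class Y (f \<circ> p)"
proof -
  have "path_class Y (f \<circ> p') = path_class Y (f \<circ> p)" if "p' \<in> path_class S p" for p'
    using f that
    by (intro path_class_eq[symmetric] homotopic_paths_continuous_image[where S = S])
       (auto simp: path_class_def)
  then show ?thesis
    unfolding induced_hom_def using path_in_path_class[OF p] by blast
qed

lemma group_fundamental_group:
  assumes "x \<in> X"
  shows "group (fundamental_group X x)"
proof -
  note PB = paths_between_def
  have joinI: "p +++ q \<in> paths_between X x x"
    if "p \<in> paths_between X x x" "q \<in> paths_between X x x" for p q
    using that by (auto simp: PB path_image_join)
  have constI: "(\<lambda>t. x) \<in> paths_between X x x"
    using assms by (auto simp: PB path_def path_image_def pathstart_def pathfinish_def)
  have revI: "reversepath p \<in> paths_between X x x" if "p \<in> paths_between X x x" for p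
    using that by (auto simp: PB)
  have lin: "linepath a a = (\<lambda>t. a)" for a :: real
    by (auto simp: linepath_def algebra_simps)
  note cm = class_mult_path_class[where X = X and x = x and y = x and z = x]
  have lid: "homotopic_paths X ((\<lambda>t. x) +++ p) p" if "p \<in> paths_between X x x" for p
  proof -
    have p: "path p" "path_image p \<subseteq> X" "p 0 = x"
      using that by (auto simp: PB pathstart_def)
    have "continuous_on {0..1} (\<lambda>t::real. max 0 (2 * t - 1))"
      by (intro continuous_intros)
    then have "homotopic_paths X p ((\<lambda>t. x) +++ p)"
      by (rule homotopic_paths_reparametrize[OF p(1,2)]) (auto simp: joinpaths_def p(3))
    then show ?thesis
      by (rule homotopic_paths_sym)
  qed
  have linv: "homotopic_paths X (reversepath p +++ p) (\<lambda>t. x)" if "p \<in> paths_between X x x" for p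
  proof -
    have p: "path p" "path_image p \<subseteq> X" "p 0 = x" "p 1 = x"
      using that by (auto simp: PB pathstart_def pathfinish_def)
    have joined: "path (linepath 1 0 +++ linepath 0 (1::real))"
      by (intro path_join_imp) auto
    have "linepath 1 0 +++ linepath 0 (1::real) \<in> {0..1} \<rightarrow> {0..1}"
      by (auto simp: joinpaths_def linepath_def)
    then have 1: "homotopic_paths {0..1} (linepath 1 0 +++ linepath 0 (1::real)) (linepath 1 1)"
      by (intro homotopic_paths_linear joined)
         (auto simp: closed_segment_eq_real_ivl Pi_iff)
    have 2: "homotopic_paths X (p \<circ> (linepath 1 0 +++ linepath 0 (1::real))) (p \<circ> linepath 1 1)"
      by (rule homotopic_paths_continuous_image[OF 1]) (use p in \<open>auto simp: path_def path_image_def\<close>)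
    have "p \<circ> (linepath 1 0 +++ linepath 0 (1::real)) = reversepath p +++ p"
      by (auto simp: fun_eq_iff joinpaths_def linepath_def reversepath_def)
    moreover have "p \<circ> linepath 1 1 = (\<lambda>t. x)"
      using p by (auto simp: fun_eq_iff linepath_def)
    ultimately show ?thesis
      using 2 by simp
  qed
  show ?thesis
  proof (rule groupI)
    show "\<one>\<^bsub>fundamental_group X x\<^esub> \<in> carrier (fundamental_group X x)"
      using constI by (auto simp: fundamental_group_def)
  next
    fix a b
    assume "a \<in> carrier (fundamental_group X x)" "b \<in> carrier (fundamental_group X x)"
    then show "a \<otimes>\<^bsub>fundamental_group X x\<^esub> b \<in> carrier (fundamental_group X x)"
      using joinI by (auto simp: fundamental_group_def cm)
  next
    fix a b c
    assume "a \<in> carrier (fundamental_group X x)" "b \<in> carrier (fundamental_group X x)"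
      "c \<in> carrier (fundamental_group X x)"
    then obtain p q r where pqr: "p \<in> paths_between X x x" "q \<in> paths_between X x x"
      "r \<in> paths_between X x x" "a = path_class X p" "b = path_class X q" "c = path_class X r"
      by (auto simp: fundamental_group_def)
    have "homotopic_paths X (p +++ (q +++ r)) ((p +++ q) +++ r)"
      using pqr by (intro homotopic_paths_assoc) (auto simp: PB)
    from path_class_eq[OF this] show "a \<otimes>\<^bsub>fundamental_group X x\<^esub> b \<otimes>\<^bsub>fundamental_group X x\<^esub> c =
        a \<otimes>\<^bsub>fundamental_group X x\<^esub> (b \<otimes>\<^bsub>fundamental_group X x\<^esub> c)"
      using pqr joinI by (simp add: fundamental_group_def cm)
  next
    fix a
    assume "a \<in> carrier (fundamental_group X x)"
    then obtain p where p: "p \<in> paths_between X x x" "a = path_class X p"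
      by (auto simp: fundamental_group_def)
    show "\<one>\<^bsub>fundamental_group X x\<^esub> \<otimes>\<^bsub>fundamental_group X x\<^esub> a = a"
      using p constI path_class_eq[OF lid] by (simp add: fundamental_group_def cm)
    show "\<exists>b\<in>carrier (fundamental_group X x). b \<otimes>\<^bsub>fundamental_group X x\<^esub> a = \<one>\<^bsub>fundamental_group X x\<^esub>"
      using p revI path_class_eq[OF linv]
      by (intro bexI[where x = "path_class X (reversepath p)"])
         (auto simp: fundamental_group_def cm)
  qed
qed


section \<open>Homotopically Hausdorff spaces relative to a subgroup\<close>

definition conj_subgroup ::
  "'a::topological_space set \<Rightarrow> (real \<Rightarrow> 'a) set set \<Rightarrow> (real \<Rightarrow> 'a) \<Rightarrow> (real \<Rightarrow> 'a) set set" where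
  "conj_subgroup X H \<alpha> =
     (\<lambda>h. class_mult X (class_mult X (path_class X (reversepath \<alpha>)) h) (path_class X \<alpha>)) ` H"

definition homotopically_Hausdorff_rel ::
  "'a::topological_space set \<Rightarrow> 'a \<Rightarrow> (real \<Rightarrow> 'a) set set \<Rightarrow> bool" where
  "homotopically_Hausdorff_rel X x0 H \<longleftrightarrow>
     (\<forall>x\<in>X. \<forall>\<alpha>\<in>paths_between X x0 x.
        \<forall>g\<in>carrier (fundamental_group X x) - conj_subgroup X H \<alpha>.
          \<exists>U. openin (top_of_set X) U \<and> x \<in> U \<and>
              \<not> (\<exists>\<delta>\<in>paths_between U x x.
                    conj_subgroup X H \<alpha> #>\<^bsub>fundamental_group X x\<^esub> g =
                    conj_subgroup X H \<alpha> #>\<^bsub>fundamental_group X x\<^esub> path_class X \<delta>))"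


section \<open>Closed subgroups\<close>

text \<open>\<open>H\<close>, a subgroup of the fundamental group of \<open>(X, x0)\<close>, is \<open>(T, g)\<close>-closed with respect to
  the based test space \<open>(S, t0)\<close>.\<close>

definition test_closed ::
  "'t::topological_space set \<Rightarrow> 't \<Rightarrow> (real \<Rightarrow> 't) set set \<Rightarrow> (real \<Rightarrow> 't) set \<Rightarrow>
   'a::topological_space set \<Rightarrow> 'a \<Rightarrow> (real \<Rightarrow> 'a) set set \<Rightarrow> bool" where
  "test_closed S t0 T g X x0 H \<longleftrightarrow>
     (\<forall>f. continuous_on S f \<and> f ` S \<subseteq> X \<and> f t0 = x0 \<and> induced_hom X f ` T \<subseteq> H \<longrightarrow>
          induced_hom X f g \<in> H)"


section \<open>The Hawaiian earring with a whisker\<close>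

definition hawaiian_earring :: "(real \<times> real) set" where
  "hawaiian_earring = (\<Union>n\<in>{1::nat..}. sphere (1 / real n, 0) (1 / real n))"

definition hawaiian_plus :: "(real \<times> real) set" where
  "hawaiian_plus = hawaiian_earring \<union> {-1..0} \<times> {0}"

definition hawaiian_plus_base :: "real \<times> real" where
  "hawaiian_plus_base = (-1, 0)"

text \<open>Counterclockwise from the origin, which lies at angle \<open>pi\<close> as seen from the centre.\<close>

definition earring_loop :: "nat \<Rightarrow> real \<Rightarrow> real \<times> real" where
  "earring_loop n t =
     (1 / real n + cos (pi + 2 * pi * t) / real n, sin (pi + 2 * pi * t) / real n)"

text \<open>For \<open>0 \<le> t < 1\<close>, the number \<open>n = \<lfloor>1 / (1 - t)\<rfloor>\<close> is the one with
  \<open>(n - 1) / n \<le> t < n / (n + 1)\<close>; this interval has length \<open>1 / (n * (n + 1))\<close>.\<close>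

definition earring_loop_inf :: "real \<Rightarrow> real \<times> real" where
  "earring_loop_inf t =
     (if t < 1 then
        let n = nat \<lfloor>1 / (1 - t)\<rfloor>
        in earring_loop n ((t - (real n - 1) / real n) * (real n * (real n + 1)))
      else (0, 0))"

lemma earring_loop_inf_1: "earring_loop_inf 1 = (0, 0)"
  by (simp add: earring_loop_inf_def)

lemma earring_loop_inf_interval:
  assumes n: "n \<ge> 1" and t: "t \<in> {(real n - 1) / real n .. real n / (real n + 1)}"
  shows "earring_loop_inf t =
    earring_loop n ((t - (real n - 1) / real n) / (real n / (real n + 1) - (real n - 1) / real n))"
proof -
  have len: "real n / (real n + 1) - (real n - 1) / real n = 1 / (real n * (real n + 1))"
    using n by (simp add: field_simps)
  have t1: "t < 1"
  proof -
    have "real n / (real n + 1) < 1" by simp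
    then show ?thesis using t by (auto intro: le_less_trans)
  qed
  show ?thesis
  proof (cases "t = real n / (real n + 1)")
    case True
    have inv: "1 / (1 - t) = real (Suc n)"
      unfolding True using n by (simp add: field_simps)
    have fl: "nat \<lfloor>1 / (1 - t)\<rfloor> = Suc n"
      unfolding inv by (simp only: floor_of_nat nat_int)
    have "t - (real (Suc n) - 1) / real (Suc n) = 0"
      unfolding True by (simp add: add.commute)
    then have "earring_loop_inf t = earring_loop (Suc n) 0"
      unfolding earring_loop_inf_def Let_def fl using t1 by (simp only: mult_zero_left if_True)
    also have "\<dots> = earring_loop n 1"
      by (simp add: earring_loop_def)
    also have "1 = (t - (real n - 1) / real n) / (real n / (real n + 1) - (real n - 1) / real n)"
      unfolding True len using n len by simp
    finally show ?thesis .
  next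
    case False
    with t have "t < real n / (real n + 1)" "(real n - 1) / real n \<le> t" by auto
    then have "real n \<le> 1 / (1 - t)" "1 / (1 - t) < real n + 1"
      using t1 n by (auto simp: field_simps)
    then have "nat \<lfloor>1 / (1 - t)\<rfloor> = n"
      by (metis floor_unique nat_int of_int_of_nat_eq)
    then show ?thesis
      using t1 unfolding len by (simp add: earring_loop_inf_def)
  qed
qed

definition whisker :: "real \<Rightarrow> real \<times> real" where
  "whisker t = (t - 1, 0)"

definition c_gen :: "nat \<Rightarrow> (real \<Rightarrow> real \<times> real) set" where
  "c_gen n = path_class hawaiian_plus (whisker +++ earring_loop n +++ reversepath whisker)"

definition C_subgroup :: "(real \<Rightarrow> real \<times> real) set set" where
  "C_subgroup = generate (fundamental_group hawaiian_plus hawaiian_plus_base) (c_gen ` {1..})"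

definition c_inf :: "(real \<Rightarrow> real \<times> real) set" where
  "c_inf = path_class hawaiian_plus (whisker +++ earring_loop_inf +++ reversepath whisker)"

end

theory Submission
  imports Defs
begin

text \<open>
  Both implications compare a product over infinitely many circles with its finite stages. Fix a
  path \<open>\<alpha>\<close> from \<open>x0\<close> to \<open>x\<close> and let \<open>K\<close> be the subgroup \<open>H\<close> transported to \<open>x\<close> along \<open>\<alpha>\<close>. A map from
  the whiskered earring that is \<open>\<alpha>\<close> on the whisker sends \<open>c\<^sub>n\<close> into \<open>H\<close> if and only if the image
  of the \<open>n\<close>-th circle represents an element of \<open>K\<close>, and likewise for \<open>c\<^sub>\<infinity>\<close> and the infinite loop
  (\<open>path_class_in_conj_subgroup_iff\<close>, \<open>induced_hom_whiskered_loop\<close>).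

  From the Hausdorff property to closedness: the image of the infinite loop can be modified by
  finitely many elements of \<open>K\<close> so that only the circles from the \<open>n\<close>-th one on remain. This does
  not change its right coset, and the remaining loops become arbitrarily small. Thus the coset is
  represented in every neighbourhood of \<open>x\<close>, which is possible only for \<open>K\<close> itself.

  From closedness to the Hausdorff property, in the first countable case: if the right coset of \<open>g\<close>
  is represented by arbitrarily small loops, choose representatives \<open>\<delta>\<^sub>n\<close> converging to \<open>x\<close> and map
  the \<open>n\<close>-th circle to \<open>\<delta>\<^sub>n\<close> followed by the reverse of \<open>\<delta>\<^sub>n\<^sub>+\<^sub>1\<close>, which represents an element of \<open>K\<close>.
  The infinite loop goes to an infinite telescoping product, which is homotopic to \<open>\<delta>\<^sub>1\<close>
  (\<open>path_class_telescope\<close>). So closedness gives \<open>[\<delta>\<^sub>1] \<in> K\<close>, hence \<open>g \<in> K\<close>.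

  Two devices keep the point-set topology short. The maps that have to be constructed come from
  \<open>continuous_factor_through_path\<close>: their domains are images of paths, so only a path in the target
  has to be continuous. The infinitely many cancellations in the telescoping product are performed
  at once, by factoring the product through a starlike set.
\<close>

section \<open>The fundamental groupoid\<close>

definition path_classes :: "'a::topological_space set \<Rightarrow> 'a \<Rightarrow> 'a \<Rightarrow> (real \<Rightarrow> 'a) set set" where
  "path_classes X x y = path_class X ` paths_between X x y"

lemma carrier_fundamental_group: "carrier (fundamental_group X x) = path_classes X x x"
  by (simp add: fundamental_group_def path_classes_def)

lemma mult_fundamental_group: "mult (fundamental_group X x) = class_mult X"
  by (simp add: fundamental_group_def)

lemma one_fundamental_group: "one (fundamental_group X x) = path_class X (\<lambda>t. x)"
  by (simp add: fundamental_group_def)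

lemmas fundamental_group_simps =
  carrier_fundamental_group mult_fundamental_group one_fundamental_group

lemma paths_between_join:
  "p \<in> paths_between X x y \<Longrightarrow> q \<in> paths_between X y z \<Longrightarrow> p +++ q \<in> paths_between X x z"
  by (auto simp: paths_between_def path_image_join)

lemma paths_between_reversepath:
  "p \<in> paths_between X x y \<Longrightarrow> reversepath p \<in> paths_between X y x"
  by (auto simp: paths_between_def)

lemma paths_between_const: "x \<in> X \<Longrightarrow> (\<lambda>t. x) \<in> paths_between X x x"
  by (auto simp: paths_between_def path_def path_image_def pathstart_def pathfinish_def)

lemma paths_between_endpoints:
  assumes "p \<in> paths_between X x y"
  shows "x \<in> X" "y \<in> X"
  using assms by (auto simp: paths_between_def path_image_def pathstart_def pathfinish_def)

lemma paths_between_mono: "U \<subseteq> X \<Longrightarrow> p \<in> paths_between U x y \<Longrightarrow> p \<in> paths_between X x y"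
  by (auto simp: paths_between_def)

lemma paths_between_compose:
  assumes "continuous_on S f" "f ` S \<subseteq> Y" "p \<in> paths_between S x y"
  shows "f \<circ> p \<in> paths_between Y (f x) (f y)"
  using assms
  by (auto simp: paths_between_def path_image_compose pathstart_compose pathfinish_compose
           intro: path_continuous_image continuous_on_subset)

lemma path_classI: "p \<in> paths_between X x y \<Longrightarrow> path_class X p \<in> path_classes X x y"
  by (simp add: path_classes_def)

lemma path_class_cong:
  assumes p: "p \<in> paths_between X x y" and eq: "\<And>t. t \<in> {0..1} \<Longrightarrow> p t = q t"
  shows "path_class X p = path_class X q"
  using p eq by (intro path_class_eq homotopic_paths_eq) (auto simp: paths_between_def)

lemma class_mult_closed:
  "a \<in> path_classes X x y \<Longrightarrow> b \<in> path_classes X y z \<Longrightarrow> class_mult X a b \<in> path_classes X x z"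
  by (auto simp: path_classes_def class_mult_path_class intro: paths_between_join)

lemma class_mult_assoc:
  assumes "a \<in> path_classes X w x" "b \<in> path_classes X x y" "c \<in> path_classes X y z"
  shows "class_mult X (class_mult X a b) c = class_mult X a (class_mult X b c)"
proof -
  obtain p q r where pqr: "p \<in> paths_between X w x" "q \<in> paths_between X x y"
      "r \<in> paths_between X y z" "a = path_class X p" "b = path_class X q" "c = path_class X r"
    using assms by (auto simp: path_classes_def)
  have "homotopic_paths X (p +++ (q +++ r)) ((p +++ q) +++ r)"
    using pqr by (intro homotopic_paths_assoc) (auto simp: paths_between_def)
  from path_class_eq[OF this] show ?thesis
    using pqr(4,5,6) class_mult_path_class[OF pqr(1,2)] class_mult_path_class[OF pqr(2,3)]
      class_mult_path_class[OF pqr(1) paths_between_join[OF pqr(2,3)]]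
      class_mult_path_class[OF paths_between_join[OF pqr(1,2)] pqr(3)]
    by simp
qed

text \<open>A constant path in front only delays the start, so it is removed by a reparametrisation.\<close>

lemma class_mult_one_left:
  assumes "a \<in> path_classes X x y"
  shows "class_mult X (path_class X (\<lambda>t. x)) a = a"
proof -
  obtain p where p: "p \<in> paths_between X x y" "a = path_class X p"
    using assms by (auto simp: path_classes_def)
  have "continuous_on {0..1} (\<lambda>t::real. max 0 (2 * t - 1))"
    by (intro continuous_intros)
  then have "homotopic_paths X p ((\<lambda>t. x) +++ p)"
    by (rule homotopic_paths_reparametrize[rotated 2])
       (use p(1) in \<open>auto simp: joinpaths_def paths_between_def pathstart_def\<close>)
  from path_class_eq[OF this] show ?thesis
    using p class_mult_path_class[OF paths_between_const p(1)] paths_between_endpoints[OF p(1)]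
    by simp
qed

lemma class_mult_one_right:
  assumes "a \<in> path_classes X x y"
  shows "class_mult X a (path_class X (\<lambda>t. y)) = a"
proof -
  obtain p where p: "p \<in> paths_between X x y" "a = path_class X p"
    using assms by (auto simp: path_classes_def)
  have "continuous_on {0..1} (\<lambda>t::real. min 1 (2 * t))"
    by (intro continuous_intros)
  moreover have "(p +++ (\<lambda>t. y)) t = p (min 1 (2 * t))" for t
    using p(1) by (cases "t \<le> 1 / 2") (auto simp: joinpaths_def paths_between_def pathfinish_def)
  ultimately have "homotopic_paths X p (p +++ (\<lambda>t. y))"
    using p(1) by (intro homotopic_paths_reparametrize[of p X "\<lambda>t. min 1 (2 * t)"])
      (auto simp: paths_between_def)
  from path_class_eq[OF this] show ?thesis
    using p class_mult_path_class[OF p(1) paths_between_const] paths_between_endpoints[OF p(1)]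
    by simp
qed

text \<open>The loop is \<open>p\<close> precomposed with a path running back and forth in the unit interval, which is
  convex, so that the precomposed path contracts there.\<close>

lemma class_mult_reversepath_left:
  assumes "p \<in> paths_between X x y"
  shows "class_mult X (path_class X (reversepath p)) (path_class X p) = path_class X (\<lambda>t. y)"
proof -
  have p: "path p" "path_image p \<subseteq> X" "p 1 = y"
    using assms by (auto simp: paths_between_def pathfinish_def)
  have joined: "path (linepath 1 0 +++ linepath 0 (1::real))"
    by (intro path_join_imp) auto
  have "linepath 1 0 +++ linepath 0 (1::real) \<in> {0..1} \<rightarrow> {0..1}"
    by (auto simp: joinpaths_def linepath_def)
  then have 1: "homotopic_paths {0..1} (linepath 1 0 +++ linepath 0 (1::real)) (linepath 1 1)"
    by (intro homotopic_paths_linear joined)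
       (auto simp: closed_segment_eq_real_ivl Pi_iff)
  have 2: "homotopic_paths X (p \<circ> (linepath 1 0 +++ linepath 0 (1::real))) (p \<circ> linepath 1 1)"
    by (rule homotopic_paths_continuous_image[OF 1]) (use p in \<open>auto simp: path_def path_image_def\<close>)
  have "p \<circ> (linepath 1 0 +++ linepath 0 (1::real)) = reversepath p +++ p"
    by (auto simp: fun_eq_iff joinpaths_def linepath_def reversepath_def)
  moreover have "p \<circ> linepath 1 1 = (\<lambda>t. y)"
    using p by (auto simp: fun_eq_iff linepath_def)
  ultimately show ?thesis
    using path_class_eq[OF 2] class_mult_path_class[OF paths_between_reversepath[OF assms] assms]
    by simp
qed

lemma class_mult_reversepath_right:
  assumes "p \<in> paths_between X x y"
  shows "class_mult X (path_class X p) (path_class X (reversepath p)) = path_class X (\<lambda>t. x)"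
  using class_mult_reversepath_left[OF paths_between_reversepath[OF assms]] by simp

section \<open>Change of base point\<close>

definition change_base ::
  "'a::topological_space set \<Rightarrow> (real \<Rightarrow> 'a) \<Rightarrow> (real \<Rightarrow> 'a) set \<Rightarrow> (real \<Rightarrow> 'a) set" where
  "change_base X \<alpha> h =
     class_mult X (class_mult X (path_class X (reversepath \<alpha>)) h) (path_class X \<alpha>)"

lemma conj_subgroup_eq_image: "conj_subgroup X H \<alpha> = change_base X \<alpha> ` H"
  by (simp add: conj_subgroup_def change_base_def)

text \<open>The conjugate subgroup \<open>H\<^sup>\<alpha>\<close> lives at the end point of \<open>\<alpha>\<close>, the test condition at the start
  point. Transport along the reversed path leads from the former to the latter.\<close>

lemma change_base_path_class:
  assumes \<alpha>: "\<alpha> \<in> paths_between X x y" and p: "p \<in> paths_between X y y"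
  shows "change_base X (reversepath \<alpha>) (path_class X p) =
         path_class X (\<alpha> +++ p +++ reversepath \<alpha>)"
proof -
  note r = paths_between_reversepath[OF \<alpha>]
  have "change_base X (reversepath \<alpha>) (path_class X p) =
      class_mult X (path_class X \<alpha>) (class_mult X (path_class X p) (path_class X (reversepath \<alpha>)))"
    unfolding change_base_def
    using class_mult_assoc[OF path_classI[OF \<alpha>] path_classI[OF p] path_classI[OF r]] by simp
  then show ?thesis
    using class_mult_path_class[OF p r] class_mult_path_class[OF \<alpha> paths_between_join[OF p r]]
    by simp
qed

lemma class_mult_cancel_middle:
  assumes p: "p \<in> paths_between X x y" and a: "a \<in> path_classes X x z"
  shows "class_mult X (path_class X p) (class_mult X (path_class X (reversepath p)) a) = a"
  using class_mult_assoc[OF path_classI[OF p] path_classI[OF paths_between_reversepath[OF p]] a]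
    class_mult_reversepath_right[OF p] class_mult_one_left[OF a] by simp

lemma change_base_closed:
  assumes "\<alpha> \<in> paths_between X x y" "a \<in> path_classes X x x"
  shows "change_base X \<alpha> a \<in> path_classes X y y"
  unfolding change_base_def
  by (rule class_mult_closed[OF class_mult_closed[OF
        path_classI[OF paths_between_reversepath[OF assms(1)]] assms(2)] path_classI[OF assms(1)]])

lemma change_base_mult:
  assumes \<alpha>: "\<alpha> \<in> paths_between X x y" and a: "a \<in> path_classes X x x"
    and b: "b \<in> path_classes X x x"
  shows "change_base X \<alpha> (class_mult X a b) =
         class_mult X (change_base X \<alpha> a) (change_base X \<alpha> b)"
proof -
  let ?A = "path_class X \<alpha>" and ?R = "path_class X (reversepath \<alpha>)"
  let ?m = "class_mult X"
  note A = path_classI[OF \<alpha>]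
  note R = path_classI[OF paths_between_reversepath[OF \<alpha>]]
  note Ra = class_mult_closed[OF R a]
  note bA = class_mult_closed[OF b A]
  have "?m (change_base X \<alpha> a) (change_base X \<alpha> b) = ?m (?m (?m ?R a) ?A) (?m ?R (?m b ?A))"
    unfolding change_base_def using class_mult_assoc[OF R b A] by simp
  also have "\<dots> = ?m (?m ?R a) (?m ?A (?m ?R (?m b ?A)))"
    by (rule class_mult_assoc[OF Ra A class_mult_closed[OF R bA]])
  also have "\<dots> = ?m (?m ?R a) (?m b ?A)"
    using class_mult_cancel_middle[OF \<alpha> bA] by simp
  also have "\<dots> = ?m (?m (?m ?R a) b) ?A"
    by (rule class_mult_assoc[OF Ra b A, symmetric])
  also have "\<dots> = change_base X \<alpha> (?m a b)"
    unfolding change_base_def using class_mult_assoc[OF R a b] by simp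
  finally show ?thesis by simp
qed

lemma change_base_inverse:
  assumes \<alpha>: "\<alpha> \<in> paths_between X x y" and a: "a \<in> path_classes X x x"
  shows "change_base X (reversepath \<alpha>) (change_base X \<alpha> a) = a"
proof -
  let ?A = "path_class X \<alpha>" and ?R = "path_class X (reversepath \<alpha>)"
  let ?m = "class_mult X"
  note A = path_classI[OF \<alpha>]
  note R = path_classI[OF paths_between_reversepath[OF \<alpha>]]
  note aA = class_mult_closed[OF a A]
  have "change_base X (reversepath \<alpha>) (change_base X \<alpha> a) = ?m (?m ?A (?m ?R (?m a ?A))) ?R"
    unfolding change_base_def using class_mult_assoc[OF R a A] by simp
  also have "\<dots> = ?m (?m a ?A) ?R"
    using class_mult_cancel_middle[OF \<alpha> aA] by simp
  also have "\<dots> = ?m a (?m ?A ?R)"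
    by (rule class_mult_assoc[OF a A R])
  also have "\<dots> = a"
    using class_mult_reversepath_right[OF \<alpha>] class_mult_one_right[OF a] by simp
  finally show ?thesis .
qed

lemma group_hom_change_base:
  assumes \<alpha>: "\<alpha> \<in> paths_between X x y"
  shows "group_hom (fundamental_group X x) (fundamental_group X y) (change_base X \<alpha>)"
proof (rule group_hom.intro)
  show "group (fundamental_group X x)" "group (fundamental_group X y)"
    using group_fundamental_group paths_between_endpoints[OF \<alpha>] by auto
  show "group_hom_axioms (fundamental_group X x) (fundamental_group X y) (change_base X \<alpha>)"
    using change_base_closed[OF \<alpha>] change_base_mult[OF \<alpha>]
    by (simp add: group_hom_axioms_def hom_def fundamental_group_simps)
qed

lemma subgroup_conj_subgroup:
  assumes "\<alpha> \<in> paths_between X x y" "subgroup H (fundamental_group X x)"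
  shows "subgroup (conj_subgroup X H \<alpha>) (fundamental_group X y)"
  unfolding conj_subgroup_eq_image
  by (rule group_hom.subgroup_img_is_subgroup[OF group_hom_change_base[OF assms(1)] assms(2)])

lemma path_class_in_conj_subgroup_iff:
  assumes \<alpha>: "\<alpha> \<in> paths_between X x y" and H: "subgroup H (fundamental_group X x)"
    and p: "p \<in> paths_between X y y"
  shows "path_class X p \<in> conj_subgroup X H \<alpha> \<longleftrightarrow>
         path_class X (\<alpha> +++ p +++ reversepath \<alpha>) \<in> H" (is "?L \<longleftrightarrow> ?R")
proof
  have sub: "H \<subseteq> path_classes X x x"
    using subgroup.subset[OF H] by (simp add: fundamental_group_simps)
  show ?R if ?L
    using that sub change_base_inverse[OF \<alpha>] change_base_path_class[OF \<alpha> p]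
    by (auto simp: conj_subgroup_eq_image)
  show ?L if ?R
    using change_base_inverse[OF paths_between_reversepath[OF \<alpha>] path_classI[OF p]]
      change_base_path_class[OF \<alpha> p] that
    unfolding conj_subgroup_eq_image by (metis reversepath_reversepath image_eqI)
qed

section \<open>Induced homomorphisms and cosets\<close>

lemma group_hom_induced_hom:
  assumes f: "continuous_on S f" "f ` S \<subseteq> Y" and s: "s \<in> S"
  shows "group_hom (fundamental_group S s) (fundamental_group Y (f s)) (induced_hom Y f)"
proof (rule group_hom.intro)
  show "group (fundamental_group S s)" "group (fundamental_group Y (f s))"
    using group_fundamental_group f s by auto
  have 1: "induced_hom Y f a \<in> path_classes Y (f s) (f s)" if "a \<in> path_classes S s s" for a
    using that induced_hom_path_class[OF f] paths_between_compose[OF f]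
    by (auto simp: path_classes_def)
  have 2: "induced_hom Y f (class_mult S a b) = class_mult Y (induced_hom Y f a) (induced_hom Y f b)"
    if ab: "a \<in> path_classes S s s" "b \<in> path_classes S s s" for a b
  proof -
    obtain p q where p: "p \<in> paths_between S s s" "a = path_class S p"
      and q: "q \<in> paths_between S s s" "b = path_class S q"
      using ab by (auto simp: path_classes_def)
    show ?thesis
      unfolding p(2) q(2) class_mult_path_class[OF p(1) q(1)]
        induced_hom_path_class[OF f p(1)] induced_hom_path_class[OF f q(1)]
        induced_hom_path_class[OF f paths_between_join[OF p(1) q(1)]]
        class_mult_path_class[OF paths_between_compose[OF f p(1)] paths_between_compose[OF f q(1)]]
        path_compose_join ..
  qed
  show "group_hom_axioms (fundamental_group S s) (fundamental_group Y (f s)) (induced_hom Y f)"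
    using 1 2 by (simp add: group_hom_axioms_def hom_def fundamental_group_simps)
qed

text \<open>The preimage of \<open>K\<close> is a subgroup, so it contains the generated subgroup as soon as it contains the
  generators.\<close>

lemma (in group_hom) image_generate_subset:
  assumes A: "A \<subseteq> carrier G" and K: "subgroup K H" and "h ` A \<subseteq> K"
  shows "h ` generate G A \<subseteq> K"
proof -
  have "h a \<in> K" if "a \<in> generate G A" for a
    using that
  proof induction
    case one
    then show ?case using subgroup.one_closed[OF K] by simp
  next
    case (incl a)
    then show ?case using assms by auto
  next
    case (inv a)
    then show ?case using assms subgroup.m_inv_closed[OF K] by (metis hom_inv image_subset_iff subsetD)
  next
    case (eng a b)
    then show ?case
      using subgroup.m_closed[OF K] G.generate_in_carrier[OF A] by simp
  qed
  then show ?thesis by auto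
qed

lemma (in group) rcos_eq_iff:
  assumes K: "subgroup K G" and "a \<in> carrier G" "b \<in> carrier G"
  shows "K #> a = K #> b \<longleftrightarrow> a \<otimes> inv b \<in> K"
  using assms rcos_self repr_independence repr_independenceD subgroup.rcos_module[OF K is_group]
  by metis

section \<open>Infinite concatenation of paths\<close>

text \<open>The \<open>n\<close>-th interval of an infinite concatenation is \<open>[node n, node (n + 1)]\<close>, for \<open>n \<ge> 1\<close>; it has
  length \<open>1 / (n * (n + 1))\<close>.\<close>

definition node :: "nat \<Rightarrow> real" where
  "node n = 1 - 1 / real n"

text \<open>The paths \<open>\<gamma> 1\<close>, \<open>\<gamma> 2\<close>, ... run through one after the other, ending at \<open>z\<close> at time \<open>1\<close>. The timing
  is the one of the loop around all circles of the earring. That loop, its image under a map, and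
  the auxiliary path through the spokes used for the telescoping homotopy are all of this form.\<close>

definition inf_concat :: "'a \<Rightarrow> (nat \<Rightarrow> real \<Rightarrow> 'a) \<Rightarrow> real \<Rightarrow> 'a" where
  "inf_concat z \<gamma> t =
     (if t < 1 then let n = nat \<lfloor>1 / (1 - t)\<rfloor> in \<gamma> n ((t - node n) * (real n * (real n + 1)))
      else z)"

lemma node_eq: "n \<ge> 1 \<Longrightarrow> node n = (real n - 1) / real n"
  by (simp add: node_def field_simps)

lemma earring_loop_inf_eq_inf_concat: "earring_loop_inf = inf_concat (0, 0) earring_loop"
proof
  fix t :: real
  show "earring_loop_inf t = inf_concat (0, 0) earring_loop t"
  proof (cases "t < 1 \<and> nat \<lfloor>1 / (1 - t)\<rfloor> = 0")
    case True
    then show ?thesis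
      by (simp add: earring_loop_inf_def inf_concat_def earring_loop_def)
  next
    case False
    define n where "n = nat \<lfloor>1 / (1 - t)\<rfloor>"
    have "t < 1 \<Longrightarrow> n \<noteq> 0" using False unfolding n_def by simp
    then have "t < 1 \<Longrightarrow> n \<ge> 1" by simp
    then show ?thesis
      unfolding earring_loop_inf_def inf_concat_def Let_def n_def[symmetric]
      by (auto simp: node_eq)
  qed
qed

lemma node_less_1: "n \<ge> 1 \<Longrightarrow> node n < 1"
  by (simp add: node_def)

lemma node_nonneg: "n \<ge> 1 \<Longrightarrow> 0 \<le> node n"
  by (simp add: node_def)

lemma node_Suc: "n \<ge> 1 \<Longrightarrow> node (Suc n) = node n + 1 / (real n * (real n + 1))"
  using add_pos_pos[of "real n" "real n * real n"] by (simp add: node_def field_simps)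

lemma node_mono: "1 \<le> m \<Longrightarrow> m \<le> n \<Longrightarrow> node m \<le> node n"
  by (simp add: node_def frac_le)

lemma node_1: "node (Suc 0) = 0"
  by (simp add: node_def)

lemma inf_concat_node_add:
  assumes n: "n \<ge> 1" and s: "0 \<le> s" "s < 1"
  shows "inf_concat z \<gamma> (node n + s / (real n * (real n + 1))) = \<gamma> n s"
proof -
  let ?t = "node n + s / (real n * (real n + 1))"
  have pos: "0 < real n * (real n + 1)" using n by simp
  have lt: "?t < node (Suc n)"
    unfolding node_Suc[OF n] using s pos by (simp add: divide_strict_right_mono)
  have t1: "?t < 1"
    using lt node_less_1[of "Suc n"] by simp
  have ge: "node n \<le> ?t" using s pos by simp
  have "1 - ?t \<le> 1 / real n" "1 / (real n + 1) < 1 - ?t"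
    using lt ge by (auto simp: node_def add.commute)
  then have "real n \<le> 1 / (1 - ?t)" "1 / (1 - ?t) < real n + 1"
    using t1 n by (auto simp: field_simps)
  then have "nat \<lfloor>1 / (1 - ?t)\<rfloor> = n"
    by (metis floor_unique nat_int of_int_of_nat_eq)
  then show ?thesis
    using t1 pos n by (simp add: inf_concat_def)
qed

lemma inf_concat_node_add':
  assumes n: "n \<ge> 1" and s: "0 \<le> s" "s \<le> 1" and join: "\<gamma> n 1 = \<gamma> (Suc n) 0"
  shows "inf_concat z \<gamma> (node n + s / (real n * (real n + 1))) = \<gamma> n s"
proof (cases "s = 1")
  case True
  then show ?thesis
    using inf_concat_node_add[of "Suc n" 0 z \<gamma>] join node_Suc[OF n] by simp
qed (use inf_concat_node_add[OF n, of s z \<gamma>] s in simp)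

lemma inf_concat_1: "inf_concat z \<gamma> 1 = z"
  by (simp add: inf_concat_def)

text \<open>The half-open condition \<open>s < 1\<close> makes the position within an interval unique, so that the value of an
  infinite concatenation there comes from one piece only.\<close>

lemma unit_interval_node_cases:
  assumes "t \<in> {0..1}"
  obtains "t = 1"
  | n s where "n \<ge> 1" "0 \<le> s" "s < 1" "t = node n + s / (real n * (real n + 1))"
proof (cases "t = 1")
  case False
  then have t: "0 \<le> t" "t < 1" using assms by auto
  define n where "n = nat \<lfloor>1 / (1 - t)\<rfloor>"
  have "1 \<le> 1 / (1 - t)" using t by simp
  then have n1: "n \<ge> 1" and n: "real n \<le> 1 / (1 - t)" "1 / (1 - t) < real n + 1"
    unfolding n_def by linarith+
  have pos: "0 < real n * (real n + 1)" using n1 by simp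
  define s where "s = (t - node n) * (real n * (real n + 1))"
  have "t - node n \<ge> 0"
    using n(1) t n1 by (simp add: node_def field_simps)
  then have "0 \<le> s" using pos by (simp add: s_def)
  moreover have "t < node (Suc n)"
    using n(2) t n1 by (simp add: node_def field_simps)
  then have "t - node n < 1 / (real n * (real n + 1))"
    using node_Suc[OF n1] by simp
  then have "s < 1"
    unfolding s_def using pos by (simp only: pos_less_divide_eq)
  moreover have "t = node n + s / (real n * (real n + 1))"
    using pos n1 by (simp add: s_def)
  ultimately show ?thesis using n1 that(2) by blast
qed (use that in simp)

lemma inf_concat_0: "inf_concat z \<gamma> 0 = \<gamma> 1 0"
  using inf_concat_node_add[of 1 0 z \<gamma>] by (simp add: node_1)

text \<open>A map sends an infinite concatenation to the infinite concatenation of the image paths, because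
  the timing does not depend on the pieces.\<close>

lemma inf_concat_compose: "f \<circ> inf_concat z \<gamma> = inf_concat (f z) (\<lambda>n. f \<circ> \<gamma> n)"
  by (auto simp: inf_concat_def fun_eq_iff Let_def)

lemma inf_concat_cong:
  assumes "t \<in> {0..1}" "\<And>n s. n \<ge> 1 \<Longrightarrow> s \<in> {0..1} \<Longrightarrow> \<gamma> n s = \<gamma>' n s"
  shows "inf_concat z \<gamma> t = inf_concat z \<gamma>' t"
  using assms(1)
proof (cases t rule: unit_interval_node_cases)
  case 1
  then show ?thesis by (simp add: inf_concat_1)
next
  case (2 n s)
  then show ?thesis using assms(2) by (simp add: inf_concat_node_add)
qed

lemma subpath_inf_concat:
  assumes "n \<ge> 1" "s \<in> {0..1}" "\<gamma> n 1 = \<gamma> (Suc n) 0"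
  shows "subpath (node n) (node (Suc n)) (inf_concat z \<gamma>) s = \<gamma> n s"
  using inf_concat_node_add'[of n s \<gamma> z] assms
  by (simp add: subpath_def node_Suc add.commute)

lemma path_image_inf_concat:
  assumes join: "\<And>n. n \<ge> 1 \<Longrightarrow> \<gamma> n 1 = \<gamma> (Suc n) 0"
  shows "path_image (inf_concat z \<gamma>) = insert z (\<Union>n\<in>{1..}. path_image (\<gamma> n))"
proof (intro equalityI subsetI)
  fix p assume "p \<in> path_image (inf_concat z \<gamma>)"
  then obtain t where t: "t \<in> {0..1}" "p = inf_concat z \<gamma> t"
    by (auto simp: path_image_def)
  from t(1) show "p \<in> insert z (\<Union>n\<in>{1..}. path_image (\<gamma> n))"
  proof (cases t rule: unit_interval_node_cases)
    case 1
    then show ?thesis using t by (simp add: inf_concat_1)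
  next
    case (2 n s)
    then have "p = \<gamma> n s" using t by (simp add: inf_concat_node_add)
    with 2 have "n \<in> {1..}" "p \<in> path_image (\<gamma> n)" by (auto simp: path_image_def)
    then show ?thesis by blast
  qed
next
  fix p assume "p \<in> insert z (\<Union>n\<in>{1..}. path_image (\<gamma> n))"
  then consider "p = z" | n s where "n \<ge> 1" "s \<in> {0..1}" "p = \<gamma> n s"
    by (auto simp: path_image_def)
  then show "p \<in> path_image (inf_concat z \<gamma>)"
  proof cases
    case 1
    then show ?thesis by (auto simp: path_image_def inf_concat_1 intro: image_eqI[of _ _ 1])
  next
    case (2 n s)
    let ?t = "node n + s / (real n * (real n + 1))"
    have pos: "0 < real n * (real n + 1)" using 2 by simp
    have "?t \<le> node (Suc n)"
      unfolding node_Suc[OF 2(1)] using 2 pos by (simp add: divide_right_mono)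
    moreover have "0 \<le> ?t" using 2 pos node_nonneg[of n] by simp
    ultimately have "?t \<in> {0..1}" using node_less_1[of "Suc n"] by simp
    then show ?thesis
      using inf_concat_node_add'[of n s \<gamma> z] join 2
      by (auto simp: path_image_def intro: image_eqI[of _ _ ?t])
  qed
qed

text \<open>Before time \<open>1\<close> only finitely many pieces are involved, and finitely many closed intervals can be
  glued. At time \<open>1\<close> continuity is exactly the hypothesis that the pieces shrink to \<open>z\<close>.\<close>

lemma path_inf_concat:
  fixes \<gamma> :: "nat \<Rightarrow> real \<Rightarrow> 'a::topological_space"
  assumes path: "\<And>n. n \<ge> 1 \<Longrightarrow> path (\<gamma> n)"
    and join: "\<And>n. n \<ge> 1 \<Longrightarrow> \<gamma> n 1 = \<gamma> (Suc n) 0"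
    and tail: "\<And>W. open W \<Longrightarrow> z \<in> W \<Longrightarrow> \<exists>N. \<forall>n\<ge>N. path_image (\<gamma> n) \<subseteq> W"
  shows "path (inf_concat z \<gamma>)"
proof -
  let ?p = "inf_concat z \<gamma>"
  have piece: "continuous_on {node n..node (Suc n)} ?p" if n: "n \<ge> 1" for n
  proof -
    have pos: "0 < real n * (real n + 1)" using n by simp
    have dom: "(t - node n) * (real n * (real n + 1)) \<in> {0..1}"
      if t: "t \<in> {node n..node (Suc n)}" for t
    proof -
      have "t - node n \<le> 1 / (real n * (real n + 1))"
        using t node_Suc[OF n] by simp
      then show ?thesis using t pos by (simp only: pos_le_divide_eq) simp
    qed
    have "continuous_on {node n..node (Suc n)} (\<gamma> n \<circ> (\<lambda>t. (t - node n) * (real n * (real n + 1))))"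
      using path[OF n] dom unfolding path_def
      by (intro continuous_on_compose continuous_intros continuous_on_subset[where t = "_ ` _"])
         (auto elim!: continuous_on_subset)
    then show ?thesis
    proof (rule continuous_on_eq)
      fix t assume t: "t \<in> {node n..node (Suc n)}"
      have "?p (node n + (t - node n) * (real n * (real n + 1)) / (real n * (real n + 1))) =
          \<gamma> n ((t - node n) * (real n * (real n + 1)))"
        by (rule inf_concat_node_add'[OF n _ _ join[OF n]]) (use dom[OF t] in auto)
      then show "(\<gamma> n \<circ> (\<lambda>t. (t - node n) * (real n * (real n + 1)))) t = ?p t"
        using pos by (simp only: nonzero_mult_div_cancel_right[OF less_imp_neq[OF pos, symmetric]]) simp
    qed
  qed
  have init: "continuous_on {0..node (Suc n)} ?p" for n
  proof (induction n)
    case 0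
    then show ?case by (simp add: node_1)
  next
    case (Suc n)
    have "{0..node (Suc (Suc n))} = {0..node (Suc n)} \<union> {node (Suc n)..node (Suc (Suc n))}"
      using node_mono[of "Suc n" "Suc (Suc n)"] node_nonneg[of "Suc n"] by auto
    then show ?case
      using Suc piece[of "Suc n"] by (simp add: continuous_on_closed_Un)
  qed
  show ?thesis
    unfolding path_def continuous_on_topological
  proof (intro ballI allI impI)
    fix t W assume t: "t \<in> {0..1}" and W: "open W" "?p t \<in> W"
    from t show "\<exists>A. open A \<and> t \<in> A \<and> (\<forall>y\<in>{0..1}. y \<in> A \<longrightarrow> ?p y \<in> W)"
    proof (cases t rule: unit_interval_node_cases)
      case 1
      obtain N where N: "\<And>n. n \<ge> N \<Longrightarrow> path_image (\<gamma> n) \<subseteq> W"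
        using tail[of W] W 1 by (auto simp: inf_concat_1)
      have "?p y \<in> W" if y: "y \<in> {0..1}" "node (Suc N) < y" for y
        using y(1)
      proof (cases y rule: unit_interval_node_cases)
        case 1
        then show ?thesis using W \<open>t = 1\<close> by simp
      next
        case (2 n s)
        have pos: "0 < real n * (real n + 1)" using 2 by simp
        have "y \<le> node (Suc n)"
          unfolding node_Suc[OF 2(1)] using 2 pos by (simp add: divide_right_mono)
        then have "n \<ge> N"
          using y(2) node_mono[of "Suc n" "Suc N"] by (cases "n \<le> N") auto
        with N[of n] 2 show ?thesis by (auto simp: inf_concat_node_add path_image_def)
      qed
      moreover have "t \<in> {node (Suc N)<..}" using 1 node_less_1[of "Suc N"] by simp
      ultimately show ?thesis by (intro exI[of _ "{node (Suc N)<..}"]) auto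
    next
      case (2 n s)
      have pos: "0 < real n * (real n + 1)" using 2 by simp
      have lt: "t < node (Suc n)"
        unfolding node_Suc[OF 2(1)] using 2 pos by (simp add: divide_strict_right_mono)
      then obtain A where A: "open A" "t \<in> A" "\<forall>y\<in>{0..node (Suc n)}. y \<in> A \<longrightarrow> ?p y \<in> W"
        using init[of n, unfolded continuous_on_topological, rule_format, of t W] W t by auto
      then show ?thesis
        using lt by (intro exI[of _ "A \<inter> {..<node (Suc n)}"]) auto
    qed
  qed
qed

section \<open>Maps on the image of a path\<close>

text \<open>A path in a Hausdorff space is a quotient map onto its image, since the unit interval is compact.
  Hence a map on the image is continuous as soon as its composite with the path is. This replaces
  every direct continuity argument for maps out of the earring, or out of the hedgehog of spokes,
  by the continuity of a single path \<open>Q\<close>.\<close>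

lemma continuous_factor_through_path:
  fixes q :: "real \<Rightarrow> 'b::t2_space" and Q :: "real \<Rightarrow> 'a::topological_space"
  assumes q: "path q" and Q: "path Q"
    and eq: "\<And>s t. s \<in> {0..1} \<Longrightarrow> t \<in> {0..1} \<Longrightarrow> q s = q t \<Longrightarrow> Q s = Q t"
  shows "\<exists>f. continuous_on (path_image q) f \<and> (\<forall>t\<in>{0..1}. f (q t) = Q t)"
proof -
  define f where "f p = Q (SOME s. s \<in> {0..1} \<and> q s = p)" for p
  have f: "f (q t) = Q t" if t: "t \<in> {0..1}" for t
    using someI[of "\<lambda>s. s \<in> {0..1} \<and> q s = q t" t] t eq unfolding f_def by blast
  have "openin (top_of_set (path_image q)) (path_image q \<inter> f -` W)" if W: "open W" for W
  proof -
    have "{0..1} \<inter> q -` (path_image q \<inter> f -` W) = {0..1} \<inter> Q -` W"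
    proof -
      have "f (q t) \<in> W \<longleftrightarrow> Q t \<in> W" if "t \<in> {0..1}" for t
        using f[OF that] by simp
      then show ?thesis by (fastforce simp: path_image_def simp del: atLeastAtMost_iff)
    qed
    moreover have "openin (top_of_set {0..1}) ({0..1} \<inter> Q -` W)"
      using Q W unfolding path_def by (simp add: continuous_openin_preimage_gen)
    ultimately show ?thesis
      using Abstract_Topology_2.continuous_imp_quotient_map[of "{0..1}" q "path_image q"
          "path_image q \<inter> f -` W"] q
      by (simp add: path_def path_image_def)
  qed
  then have "continuous_on (path_image q) f"
    by (simp add: continuous_openin_preimage_eq)
  with f show ?thesis by blast
qed

section \<open>Infinite telescoping products\<close>

text \<open>Spoke \<open>n\<close> runs from the tip \<open>(1/n, 1/n\<^sup>2)\<close> to the origin. The slopes \<open>1/n\<close> differ, so that two spokes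
  share only the origin, and the tips converge to it.\<close>

definition spoke :: "nat \<Rightarrow> real \<Rightarrow> real \<times> real" where
  "spoke n s = ((1 - s) / real n, (1 - s) / (real n)\<^sup>2)"

lemma spoke_eq_iff:
  assumes "n \<ge> 1" "m \<ge> 1" "spoke n s = spoke m t"
  shows "s = 1 \<and> t = 1 \<or> n = m \<and> s = t"
proof (cases "s = 1")
  case True
  then show ?thesis using assms by (auto simp: spoke_def)
next
  case False
  have 1: "(1 - s) / real n = (1 - t) / real m"
    and sq: "(1 - s) / (real n)\<^sup>2 = (1 - t) / (real m)\<^sup>2"
    using assms(3) by (simp_all add: spoke_def)
  have 2: "(1 - s) / real n / real n = (1 - t) / real m / real m"
    using sq by (simp add: power2_eq_square)
  have "(1 - t) / real m / real n = (1 - t) / real m / real m"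
    using 2 unfolding 1 .
  moreover have "(1 - t) / real m \<noteq> 0" unfolding 1[symmetric] using False assms(1) by simp
  ultimately have "n = m" by (simp only: divide_cancel_left) simp
  then show ?thesis using 1 assms by auto
qed

lemma path_spoke: "path (spoke n)"
  unfolding path_def spoke_def by (auto intro!: continuous_intros simp: divide_inverse)

lemma spoke_ends: "spoke n 1 = (0, 0)"
  by (simp add: spoke_def)

lemma norm_spoke_le:
  assumes "n \<ge> 1" "s \<in> {0..1}"
  shows "norm (spoke n s) \<le> 2 / real n"
proof -
  have "norm (spoke n s) \<le> (1 - s) / real n + (1 - s) / (real n)\<^sup>2"
    using norm_Pair_le[of "(1 - s) / real n" "(1 - s) / (real n)\<^sup>2"] assms
    by (simp add: spoke_def)
  also have "\<dots> \<le> 1 / real n + 1 / real n"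
    using assms by (intro add_mono frac_le) (auto simp: power2_eq_square)
  finally show ?thesis by simp
qed

lemma starlike_spokes: "starlike (\<Union>n\<in>{1..}. spoke n ` {0..1})"
  unfolding starlike_def
proof (intro bexI ballI subsetI)
  show "(0, 0) \<in> (\<Union>n\<in>{1..}. spoke n ` {0..1})"
    by (auto intro!: bexI[of _ 1] image_eqI[of _ _ 1] simp: spoke_def)
  fix p r assume "p \<in> (\<Union>n\<in>{1..}. spoke n ` {0..1})" and r: "r \<in> closed_segment (0, 0) p"
  then obtain n s where n: "n \<ge> 1" "s \<in> {0..1}" "p = spoke n s" by auto
  obtain u where u: "0 \<le> u" "u \<le> 1" "r = (1 - u) *\<^sub>R (0, 0) + u *\<^sub>R p"
    using r by (auto simp: closed_segment_def)
  have "r = spoke n (1 - u * (1 - s))"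
    using n u by (simp add: spoke_def)
  moreover have "1 - u * (1 - s) \<in> {0..1}"
    using n u by (simp add: mult_le_one)
  ultimately show "r \<in> (\<Union>n\<in>{1..}. spoke n ` {0..1})" using n(1) by blast
qed

text \<open>The infinite word \<open>\<delta>\<^sub>1 \<delta>\<^sub>2\<^sup>- \<delta>\<^sub>2 \<delta>\<^sub>3\<^sup>- \<delta>\<^sub>3 \<dots>\<close> collapses to \<open>\<delta>\<^sub>1\<close>, although infinitely many
  cancellations take place at once. The path factors through the hedgehog of spokes, by a map \<open>G\<close>
  that is \<open>\<delta>\<^sub>n\<close> along spoke \<open>n\<close>: the path \<open>\<psi>\<close> in the hedgehog walks from tip \<open>n\<close> to the centre and
  out to tip \<open>n + 1\<close>, for every \<open>n\<close>. The hedgehog is starlike, hence simply connected, so \<open>\<psi>\<close> is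
  homotopic to the first spoke alone, and \<open>G\<close> carries this homotopy to the given space.\<close>

lemma path_class_telescope:
  fixes \<delta> :: "nat \<Rightarrow> real \<Rightarrow> 'a::topological_space"
  assumes \<delta>: "\<And>n. n \<ge> 1 \<Longrightarrow> \<delta> n \<in> paths_between X (y n) x"
    and tail: "\<And>W. open W \<Longrightarrow> x \<in> W \<Longrightarrow> \<exists>N. \<forall>n\<ge>N. path_image (\<delta> n) \<subseteq> W"
  shows "inf_concat x (\<lambda>n. \<delta> n +++ reversepath (\<delta> (Suc n))) \<in> paths_between X (y 1) x"
    and "path_class X (inf_concat x (\<lambda>n. \<delta> n +++ reversepath (\<delta> (Suc n)))) = path_class X (\<delta> 1)"
proof -
  define \<gamma> where "\<gamma> n = \<delta> n +++ reversepath (\<delta> (Suc n))" for n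
  define \<sigma> where "\<sigma> n = spoke n +++ reversepath (spoke (Suc n))" for n
  let ?\<Gamma> = "inf_concat x \<gamma>" and ?\<psi> = "inf_concat (0, 0) \<sigma>"
  let ?E = "\<Union>n\<in>{1..}. spoke n ` {0..1}"
  have \<delta>': "path (\<delta> n)" "path_image (\<delta> n) \<subseteq> X" "\<delta> n 0 = y n" "\<delta> n 1 = x" if "n \<ge> 1" for n
    using \<delta>[OF that] by (auto simp: paths_between_def pathstart_def pathfinish_def)
  have join\<gamma>: "\<gamma> n 1 = \<gamma> (Suc n) 0" if "n \<ge> 1" for n
    using that \<delta>'(3)[of "Suc n"] by (simp add: \<gamma>_def joinpaths_def reversepath_def)
  have join\<sigma>: "\<sigma> n 1 = \<sigma> (Suc n) 0" for n
    by (simp add: \<sigma>_def joinpaths_def reversepath_def)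
  have image\<gamma>: "path_image (\<gamma> n) = path_image (\<delta> n) \<union> path_image (\<delta> (Suc n))" if "n \<ge> 1" for n
    using that \<delta>'[of n] \<delta>'[of "Suc n"] unfolding \<gamma>_def
    by (subst path_image_join) (simp_all add: pathfinish_def)
  have image\<sigma>: "path_image (\<sigma> n) = path_image (spoke n) \<union> path_image (spoke (Suc n))" for n
    unfolding \<sigma>_def
    by (subst path_image_join) (simp_all add: pathfinish_def spoke_ends)
  have path\<Gamma>: "path ?\<Gamma>"
  proof (rule path_inf_concat)
    show "path (\<gamma> n)" if "n \<ge> 1" for n
      using that \<delta>'[of n] \<delta>'[of "Suc n"] unfolding \<gamma>_def
      by (intro path_join_imp) (auto simp: pathfinish_def)
    show "\<exists>N. \<forall>n\<ge>N. path_image (\<gamma> n) \<subseteq> W" if W: "open W" "x \<in> W" for W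
    proof -
      obtain N where "\<forall>n\<ge>N. path_image (\<delta> n) \<subseteq> W" using tail[OF W] by auto
      then have "\<forall>n\<ge>max 1 N. path_image (\<gamma> n) \<subseteq> W" using image\<gamma> by simp
      then show ?thesis by blast
    qed
  qed (use join\<gamma> in auto)
  have path\<psi>: "path ?\<psi>"
  proof (rule path_inf_concat)
    show "path (\<sigma> n)" for n
      unfolding \<sigma>_def
      by (intro path_join_imp path_spoke)
         (auto simp: path_spoke pathfinish_def spoke_ends)
    show "\<exists>N. \<forall>n\<ge>N. path_image (\<sigma> n) \<subseteq> W" if W: "open W" "(0, 0) \<in> W" for W
    proof -
      obtain e where e: "e > 0" "ball (0, 0) e \<subseteq> W" using W by (auto simp: open_contains_ball)
      obtain N :: nat where N: "2 / e < real N" using reals_Archimedean2 by blast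
      have "path_image (spoke n) \<subseteq> W" if n: "n \<ge> Suc N" for n
      proof -
        have "2 / e < real n" using N n by simp
        then have "2 / real n < e" using e n by (simp add: field_simps)
        then have "norm (spoke n s) < e" if "s \<in> {0..1}" for s
          using norm_spoke_le[of n s] n that by simp
        then have "spoke n s \<in> ball (0, 0) e" if "s \<in> {0..1}" for s
          using that by (simp flip: zero_prod_def)
        then show ?thesis
          using e(2) by (auto simp only: path_image_def)
      qed
      then have "\<forall>n\<ge>Suc N. path_image (\<sigma> n) \<subseteq> W" using image\<sigma> by simp
      then show ?thesis by blast
    qed
  qed (use join\<sigma> in auto)
  have image\<Gamma>: "path_image ?\<Gamma> \<subseteq> X"
    using path_image_inf_concat[of \<gamma> x, OF join\<gamma>] image\<gamma> \<delta>'(2) paths_between_endpoints[OF \<delta>[of 1]]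
    by force
  have image\<psi>: "path_image ?\<psi> = ?E"
  proof -
    have "path_image ?\<psi> = insert (0, 0) (\<Union>n\<in>{1..}. path_image (spoke n) \<union> path_image (spoke (Suc n)))"
      using path_image_inf_concat[of \<sigma> "(0, 0)", OF join\<sigma>] image\<sigma> by simp
    also have "\<dots> = (\<Union>n\<in>{1..}. path_image (spoke n))"
      using spoke_ends[of 1] by (fastforce simp: path_image_def intro: rev_image_eqI[of 1])
    finally show ?thesis by (simp add: path_image_def)
  qed
  \<comment> \<open>At every time, both paths are at the same parameter of the same spoke; hence the second one is a function of the first.\<close>
  have pair: "\<exists>n s. n \<ge> 1 \<and> s \<in> {0..1} \<and> ?\<psi> t = spoke n s \<and> ?\<Gamma> t = \<delta> n s" if t: "t \<in> {0..1}" for t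
    using t
  proof (cases t rule: unit_interval_node_cases)
    case 1
    then show ?thesis
      using \<delta>'[of 1] spoke_ends[of 1] by (intro exI[of _ 1]) (auto simp: inf_concat_1)
  next
    case (2 n s)
    show ?thesis
    proof (cases "s \<le> 1 / 2")
      case True
      with 2 show ?thesis
        by (intro exI[of _ n] exI[of _ "2 * s"])
           (auto simp: inf_concat_node_add \<gamma>_def \<sigma>_def joinpaths_def)
    next
      case False
      with 2 show ?thesis
        by (intro exI[of _ "Suc n"] exI[of _ "1 - (2 * s - 1)"])
           (auto simp: inf_concat_node_add \<gamma>_def \<sigma>_def joinpaths_def reversepath_def)
    qed
  qed
  \<comment> \<open>Distinct spokes meet only at the centre, where every \<open>\<delta>\<^sub>n\<close> has the value \<open>x\<close>.\<close>
  have eq: "?\<Gamma> s = ?\<Gamma> t" if st: "s \<in> {0..1}" "t \<in> {0..1}" "?\<psi> s = ?\<psi> t" for s t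
  proof -
    obtain n u where 1: "n \<ge> 1" "?\<psi> s = spoke n u" "?\<Gamma> s = \<delta> n u"
      using pair[OF st(1)] by blast
    obtain m v where 2: "m \<ge> 1" "?\<psi> t = spoke m v" "?\<Gamma> t = \<delta> m v"
      using pair[OF st(2)] by blast
    have "u = 1 \<and> v = 1 \<or> n = m \<and> u = v"
      using spoke_eq_iff[OF 1(1) 2(1)] 1(2) 2(2) st(3) by simp
    then have "\<delta> n u = \<delta> m v"
      using \<delta>'(4)[OF 1(1)] \<delta>'(4)[OF 2(1)] by auto
    then show ?thesis using 1(3) 2(3) by simp
  qed
  obtain G where G: "continuous_on ?E G" "\<And>t. t \<in> {0..1} \<Longrightarrow> G (?\<psi> t) = ?\<Gamma> t"
    using continuous_factor_through_path[OF path\<psi> path\<Gamma> eq, unfolded image\<psi>] by metis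
  have GE: "G ` ?E \<subseteq> X"
    using G(2) image\<Gamma> unfolding image\<psi>[symmetric] path_image_def by auto
  have G_spoke: "G (spoke n s) = \<delta> n s" if n: "n \<ge> 1" and s: "s \<in> {0..1}" for n s
  proof -
    have "spoke n s \<in> path_image ?\<psi>" unfolding image\<psi> using n s by (intro UN_I[of n] imageI) auto
    then obtain t where t: "t \<in> {0..1}" "?\<psi> t = spoke n s" by (auto simp: path_image_def)
    obtain m v where m: "m \<ge> 1" "?\<psi> t = spoke m v" "?\<Gamma> t = \<delta> m v"
      using pair[OF t(1)] by blast
    have "v = 1 \<and> s = 1 \<or> m = n \<and> v = s"
      using spoke_eq_iff[OF m(1) n] m(2) t(2) by simp
    then have "\<delta> m v = \<delta> n s"
      using \<delta>'(4)[OF m(1)] \<delta>'(4)[OF n] by auto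
    then show ?thesis using G(2)[OF t(1)] t m by simp
  qed
  have hom: "homotopic_paths ?E ?\<psi> (spoke 1)"
  proof -
    have "simply_connected ?E"
      by (rule starlike_imp_simply_connected[OF starlike_spokes])
    moreover have "pathstart (spoke 1) = pathstart ?\<psi>" "pathfinish (spoke 1) = pathfinish ?\<psi>"
      by (simp_all add: pathstart_def pathfinish_def inf_concat_0 inf_concat_1 \<sigma>_def
            joinpaths_def spoke_ends)
    moreover have "path_image (spoke 1) \<subseteq> ?E" by (auto simp: path_image_def)
    ultimately show ?thesis
      using path\<psi> image\<psi> path_spoke by (auto simp: simply_connected_eq_homotopic_paths)
  qed
  have start\<Gamma>: "pathstart ?\<Gamma> = y 1" "pathfinish ?\<Gamma> = x"
    using \<delta>'(3)[of 1]
    by (simp_all add: pathstart_def pathfinish_def inf_concat_0 inf_concat_1 \<gamma>_def joinpaths_def)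
  have \<Gamma>: "?\<Gamma> \<in> paths_between X (y 1) x"
    using path\<Gamma> image\<Gamma> start\<Gamma> by (simp add: paths_between_def)
  have "path_class X ?\<Gamma> = path_class X (G \<circ> ?\<psi>)"
    by (rule path_class_cong[OF \<Gamma>]) (simp add: G)
  also have "\<dots> = path_class X (G \<circ> spoke 1)"
    by (rule path_class_eq[OF homotopic_paths_continuous_image[OF hom G(1)]]) (use GE in auto)
  also have "\<dots> = path_class X (\<delta> 1)"
    by (rule path_class_cong[OF \<delta>, symmetric]) (simp_all add: G_spoke)
  finally show "path_class X (inf_concat x (\<lambda>n. \<delta> n +++ reversepath (\<delta> (Suc n)))) = path_class X (\<delta> 1)"
    by (simp add: \<gamma>_def[abs_def])
  show "inf_concat x (\<lambda>n. \<delta> n +++ reversepath (\<delta> (Suc n))) \<in> paths_between X (y 1) x"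
    using \<Gamma> by (simp add: \<gamma>_def[abs_def])
qed

section \<open>Maps on the whiskered Hawaiian earring\<close>

lemma earring_loop_eq:
  "earring_loop n t = ((1 - cos (2 * pi * t)) / real n, - sin (2 * pi * t) / real n)"
  by (simp add: earring_loop_def cos_add sin_add diff_divide_distrib)

lemma earring_loop_ends: "earring_loop n 0 = (0, 0)" "earring_loop n 1 = (0, 0)"
  by (simp_all add: earring_loop_eq)

lemma path_earring_loop: "path (earring_loop n)"
  unfolding path_def earring_loop_eq by (auto intro!: continuous_intros simp: divide_inverse)

text \<open>Away from the origin, this equation determines \<open>n\<close> from the point: different circles meet only at
  the origin.\<close>

lemma earring_loop_circle:
  assumes "n \<ge> 1"
  shows "(fst (earring_loop n t))\<^sup>2 + (snd (earring_loop n t))\<^sup>2 = 2 * fst (earring_loop n t) / real n"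
proof -
  let ?u = "2 * pi * t"
  have "(1 - cos ?u)\<^sup>2 + (sin ?u)\<^sup>2 = 1 - 2 * cos ?u + ((sin ?u)\<^sup>2 + (cos ?u)\<^sup>2)"
    by (simp only: power2_diff) simp
  then have "(1 - cos ?u)\<^sup>2 + (sin ?u)\<^sup>2 = 2 * (1 - cos ?u)"
    by simp
  then show ?thesis
    unfolding earring_loop_eq fst_conv snd_conv power_divide power2_minus
      add_divide_distrib[symmetric]
    by (simp add: power2_eq_square)
qed

lemma fst_earring_loop_nonneg: "0 \<le> fst (earring_loop n t)"
  by (simp add: earring_loop_eq)

lemma fst_earring_loop_eq_0D:
  assumes "n \<ge> 1" "t \<in> {0..1}" "fst (earring_loop n t) = 0"
  shows "t = 0 \<or> t = 1"
proof -
  have "cos (2 * pi * t) = 1" using assms by (simp add: earring_loop_eq)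
  then obtain k :: int where "2 * pi * t = of_int k * 2 * pi"
    by (auto simp: cos_one_2pi_int)
  then have "t = of_int k" by simp
  then show ?thesis using assms(2) by auto
qed

lemma earring_loop_inj:
  assumes "n \<ge> 1" "s \<in> {0..1}" "t \<in> {0..1}" "earring_loop n s = earring_loop n t"
  shows "s = t \<or> {s, t} \<subseteq> {0, 1}"
proof -
  have "sin (2 * pi * s) = sin (2 * pi * t) \<and> cos (2 * pi * s) = cos (2 * pi * t)"
    using assms by (simp add: earring_loop_eq)
  then obtain k :: int where "2 * pi * s = 2 * pi * t + 2 * pi * of_int k"
    by (auto simp: sin_cos_eq_iff)
  then have "2 * pi * s = 2 * pi * (t + of_int k)" by (simp add: distrib_left)
  then have k: "s = t + of_int k" by simp
  then have "\<bar>of_int k :: real\<bar> \<le> 1" using assms(2,3) by auto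
  then have "k = 0 \<or> k = 1 \<or> k = -1" by linarith
  then show ?thesis using k assms(2,3) by auto
qed

lemma path_image_earring_loop:
  assumes n: "n \<ge> 1"
  shows "path_image (earring_loop n) = sphere (1 / real n, 0) (1 / real n)"
proof (intro equalityI subsetI)
  fix p assume "p \<in> path_image (earring_loop n)"
  then obtain t where p: "p = earring_loop n t" by (auto simp: path_image_def)
  have "dist (1 / real n, 0) p = sqrt ((cos (2 * pi * t) / real n)\<^sup>2 + (sin (2 * pi * t) / real n)\<^sup>2)"
    by (simp add: p earring_loop_eq dist_Pair_Pair dist_real_def diff_divide_distrib power_divide)
  also have "(cos (2 * pi * t) / real n)\<^sup>2 + (sin (2 * pi * t) / real n)\<^sup>2 =
      ((cos (2 * pi * t))\<^sup>2 + (sin (2 * pi * t))\<^sup>2) / (real n)\<^sup>2"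
    by (simp only: power_divide add_divide_distrib)
  also have "\<dots> = (1 / real n)\<^sup>2"
    by (simp only: sin_cos_squared_add2 power_divide power_one)
  also have "sqrt ((1 / real n)\<^sup>2) = 1 / real n"
    by simp
  finally show "p \<in> sphere (1 / real n, 0) (1 / real n)" by simp
next
  fix p :: "real \<times> real" assume p: "p \<in> sphere (1 / real n, 0) (1 / real n)"
  obtain x y where xy: "p = (x, y)" by (cases p)
  have pos: "real n > 0" using n by simp
  have "sqrt ((1 / real n - x)\<^sup>2 + y\<^sup>2) = 1 / real n"
    using p by (simp add: xy dist_Pair_Pair dist_real_def)
  then have "(1 / real n - x)\<^sup>2 + y\<^sup>2 = (1 / real n)\<^sup>2"
    by (metis real_sqrt_pow2 add_nonneg_nonneg zero_le_power2)
  then have "(real n)\<^sup>2 * ((1 / real n - x)\<^sup>2 + y\<^sup>2) = 1"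
    using pos by (simp add: power_divide)
  moreover have scale: "1 - real n * x = real n * (1 / real n - x)"
    using pos by (simp add: right_diff_distrib)
  have "(1 - real n * x)\<^sup>2 + (- real n * y)\<^sup>2 = (real n)\<^sup>2 * ((1 / real n - x)\<^sup>2 + y\<^sup>2)"
    unfolding scale by (simp add: power_mult_distrib distrib_left)
  ultimately have "(1 - real n * x)\<^sup>2 + (- real n * y)\<^sup>2 = 1"
    by simp
  then obtain \<theta> where \<theta>: "0 \<le> \<theta>" "\<theta> \<le> 2 * pi" "1 - real n * x = cos \<theta>" "- real n * y = sin \<theta>"
    using sincos_total_2pi_le by blast
  have "p = earring_loop n (\<theta> / (2 * pi))"
    using \<theta>(3,4) pos by (simp add: xy earring_loop_eq field_simps)
  moreover have "\<theta> / (2 * pi) \<in> {0..1}" using \<theta> by simp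
  ultimately show "p \<in> path_image (earring_loop n)" unfolding path_image_def by blast
qed

lemma path_earring_loop_inf: "path earring_loop_inf"
  unfolding earring_loop_inf_eq_inf_concat
proof (rule path_inf_concat)
  fix W :: "(real \<times> real) set" assume W: "open W" "(0, 0) \<in> W"
  obtain e where e: "e > 0" "ball (0, 0) e \<subseteq> W" using W by (auto simp: open_contains_ball)
  obtain N :: nat where N: "2 / e < real N" using reals_Archimedean2 by blast
  have "path_image (earring_loop n) \<subseteq> W" if n: "n \<ge> Suc N" for n
  proof
    fix p assume "p \<in> path_image (earring_loop n)"
    then have p: "p \<in> sphere (1 / real n, 0) (1 / real n)"
      using path_image_earring_loop[of n] n by simp
    have "2 / e < real n" using N n by simp
    then have "2 / real n < e" using e n by (simp add: field_simps)
    moreover have "dist (0, 0) p \<le> dist (0, 0) (1 / real n, 0 :: real) + dist (1 / real n, 0) p"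
      by (rule dist_triangle)
    ultimately have "dist (0, 0) p < e"
      using p by (simp add: dist_Pair_Pair dist_real_def)
    then show "p \<in> W" using e by auto
  qed
  then show "\<exists>N. \<forall>n\<ge>N. path_image (earring_loop n) \<subseteq> W" by blast
qed (auto simp: path_earring_loop earring_loop_ends)

lemma path_image_earring_loop_inf: "path_image earring_loop_inf = hawaiian_earring"
proof -
  have "path_image earring_loop_inf = insert (0, 0) (\<Union>n\<in>{1..}. path_image (earring_loop n))"
    unfolding earring_loop_inf_eq_inf_concat
    by (rule path_image_inf_concat) (simp add: earring_loop_ends)
  also have "\<dots> = (\<Union>n\<in>{1..}. path_image (earring_loop n))"
  proof (rule insert_absorb)
    have "(0, 0) \<in> path_image (earring_loop 1)"
      using pathstart_in_path_image[of "earring_loop 1"] by (simp add: pathstart_def earring_loop_ends)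
    then show "(0, 0) \<in> (\<Union>n\<in>{1..}. path_image (earring_loop n))" by (intro UN_I[of 1]) auto
  qed
  also have "\<dots> = hawaiian_earring"
    unfolding hawaiian_earring_def by (rule SUP_cong) (auto simp: path_image_earring_loop)
  finally show ?thesis .
qed

lemma path_image_whisker: "path_image whisker = {-1..0} \<times> {0}"
proof (intro equalityI subsetI)
  fix p :: "real \<times> real" assume "p \<in> {-1..0} \<times> {0}"
  then have "p = whisker (fst p + 1)" "fst p + 1 \<in> {0..1}" by (auto simp: whisker_def)
  then show "p \<in> path_image whisker" unfolding path_image_def by blast
qed (auto simp: path_image_def whisker_def)

lemma path_whisker: "path whisker"
  unfolding path_def whisker_def by (intro continuous_intros)

lemma whisker_paths_between: "whisker \<in> paths_between hawaiian_plus hawaiian_plus_base (0, 0)"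
  using path_whisker path_image_whisker
  by (auto simp: paths_between_def hawaiian_plus_def hawaiian_plus_base_def pathstart_def
        pathfinish_def whisker_def)

lemma earring_loop_paths_between:
  "n \<ge> 1 \<Longrightarrow> earring_loop n \<in> paths_between hawaiian_plus (0, 0) (0, 0)"
  using path_earring_loop[of n] path_image_earring_loop[of n]
  by (auto simp: paths_between_def hawaiian_plus_def hawaiian_earring_def pathstart_def
        pathfinish_def earring_loop_ends)

lemma earring_loop_inf_paths_between:
  "earring_loop_inf \<in> paths_between hawaiian_plus (0, 0) (0, 0)"
  using path_earring_loop_inf path_image_earring_loop_inf
  by (auto simp: paths_between_def hawaiian_plus_def pathstart_def pathfinish_def
        earring_loop_inf_eq_inf_concat inf_concat_0 inf_concat_1 earring_loop_ends)

text \<open>The space is the image of the single path \<open>whisker\<close> followed by the loop through all circles. A map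
  with prescribed values on the whisker and the circles is therefore continuous because
  \<open>\<alpha>\<close> followed by the infinite concatenation of the \<open>\<gamma> n\<close> is a path, which is where the loops are
  required to shrink to \<open>x\<close>.\<close>

lemma hawaiian_plus_map_exists:
  fixes \<gamma> :: "nat \<Rightarrow> real \<Rightarrow> 'a::topological_space"
  assumes \<alpha>: "\<alpha> \<in> paths_between X x0 x"
    and \<gamma>: "\<And>n. n \<ge> 1 \<Longrightarrow> \<gamma> n \<in> paths_between X x x"
    and tail: "\<And>W. open W \<Longrightarrow> x \<in> W \<Longrightarrow> \<exists>N. \<forall>n\<ge>N. path_image (\<gamma> n) \<subseteq> W"
  shows "\<exists>f. continuous_on hawaiian_plus f \<and> f ` hawaiian_plus \<subseteq> X \<and>
      (\<forall>s\<in>{0..1}. f (whisker s) = \<alpha> s) \<and> (\<forall>n\<ge>1. \<forall>s\<in>{0..1}. f (earring_loop n s) = \<gamma> n s)"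
proof -
  let ?q = "whisker +++ earring_loop_inf" and ?Q = "\<alpha> +++ inf_concat x \<gamma>"
  have \<alpha>': "path \<alpha>" "path_image \<alpha> \<subseteq> X" "\<alpha> 0 = x0" "\<alpha> 1 = x"
    using \<alpha> by (auto simp: paths_between_def pathstart_def pathfinish_def)
  have \<gamma>': "path (\<gamma> n)" "path_image (\<gamma> n) \<subseteq> X" "\<gamma> n 0 = x" "\<gamma> n 1 = x" if "n \<ge> 1" for n
    using \<gamma>[OF that] by (auto simp: paths_between_def pathstart_def pathfinish_def)
  have join: "\<gamma> n 1 = \<gamma> (Suc n) 0" if "n \<ge> 1" for n
    using \<gamma>' that by simp
  have "path (inf_concat x \<gamma>)"
    by (rule path_inf_concat[OF \<gamma>'(1) join tail])
  moreover have "path_image (inf_concat x \<gamma>) \<subseteq> X"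
  proof -
    have "path_image (inf_concat x \<gamma>) = insert x (\<Union>n\<in>{1..}. path_image (\<gamma> n))"
      by (rule path_image_inf_concat) (rule join)
    then show ?thesis using \<gamma>'(2) paths_between_endpoints(2)[OF \<alpha>] by auto
  qed
  ultimately have "inf_concat x \<gamma> \<in> paths_between X x x"
    using \<gamma>'(3)[of 1] by (auto simp: paths_between_def pathstart_def pathfinish_def inf_concat_0 inf_concat_1)
  then have Q: "path ?Q" "path_image ?Q \<subseteq> X"
    using paths_between_join[OF \<alpha>] by (auto simp: paths_between_def)
  have q: "path ?q"
    using paths_between_join[OF whisker_paths_between earring_loop_inf_paths_between]
    by (simp add: paths_between_def)
  have image_q: "path_image ?q = hawaiian_plus"
  proof -
    have "pathfinish whisker = pathstart earring_loop_inf"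
      using whisker_paths_between earring_loop_inf_paths_between by (simp add: paths_between_def)
    then show ?thesis
      by (simp add: path_image_join path_image_whisker path_image_earring_loop_inf
            hawaiian_plus_def Un_commute)
  qed
  \<comment> \<open>The graph of the map to be constructed.\<close>
  define R where "R = {(whisker s, \<alpha> s) | s. s \<in> {0..1}} \<union>
      {(earring_loop n s, \<gamma> n s) | n s. n \<ge> 1 \<and> s \<in> {0..1}}"
  have R_whisker: "(whisker s, \<alpha> s) \<in> R" if "s \<in> {0..1}" for s
    using that unfolding R_def by blast
  have R_loop: "(earring_loop n s, \<gamma> n s) \<in> R" if "n \<ge> 1" "s \<in> {0..1}" for n s
    using that unfolding R_def by blast
  have cross: "\<alpha> s = \<gamma> n t"
    if "whisker s = earring_loop n t" "s \<in> {0..1}" "n \<ge> 1" "t \<in> {0..1}" for s n t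
  proof -
    have "fst (earring_loop n t) = s - 1" using that(1)[symmetric] by (simp add: whisker_def)
    then have "s = 1" "fst (earring_loop n t) = 0"
      using fst_earring_loop_nonneg[of n t] that(2) by auto
    then have "\<gamma> n t = x"
      using fst_earring_loop_eq_0D[OF that(3,4)] \<gamma>'(3,4)[OF that(3)] by auto
    then show ?thesis using \<alpha>'(4) \<open>s = 1\<close> by simp
  qed
  have circles: "\<gamma> n s = \<gamma> m t"
    if "earring_loop n s = earring_loop m t" "n \<ge> 1" "m \<ge> 1" "s \<in> {0..1}" "t \<in> {0..1}" for n m s t
  proof (cases "fst (earring_loop n s) = 0")
    case True
    then have "s \<in> {0, 1}" "t \<in> {0, 1}"
      using fst_earring_loop_eq_0D[of n s] fst_earring_loop_eq_0D[of m t] that by auto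
    then show ?thesis using \<gamma>'(3,4) that(2,3) by auto
  next
    case False
    have "2 * fst (earring_loop n s) / real n = 2 * fst (earring_loop n s) / real m"
      using trans[OF sym[OF earring_loop_circle[OF that(2), of s]]
          earring_loop_circle[OF that(3), of t, folded that(1)]] .
    then have "n = m" using False by (simp only: divide_cancel_left) simp
    then have "s = t \<or> {s, t} \<subseteq> {0, 1}"
      using earring_loop_inj[OF that(2,4,5)] that(1) by simp
    then have "\<gamma> n s = \<gamma> n t"
      using \<gamma>'(3,4)[OF that(2)] by auto
    then show ?thesis using \<open>n = m\<close> by simp
  qed
  have R_single: "a = b" if "(p, a) \<in> R" "(p, b) \<in> R" for p a b
    using that(1)
    unfolding R_def
  proof (elim UnE CollectE exE conjE)
    fix s assume 1: "(p, a) = (whisker s, \<alpha> s)" "s \<in> {0..1}"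
    from that(2) show "a = b"
      unfolding R_def
    proof (elim UnE CollectE exE conjE)
      fix t assume "(p, b) = (whisker t, \<alpha> t)" "t \<in> {0..1}"
      with 1 show ?thesis by (simp add: whisker_def)
    next
      fix n t assume "(p, b) = (earring_loop n t, \<gamma> n t)" "1 \<le> n" "t \<in> {0..1}"
      with 1 show ?thesis using cross[of s n t] by simp
    qed
  next
    fix n s assume 1: "(p, a) = (earring_loop n s, \<gamma> n s)" "1 \<le> n" "s \<in> {0..1}"
    from that(2) show "a = b"
      unfolding R_def
    proof (elim UnE CollectE exE conjE)
      fix t assume "(p, b) = (whisker t, \<alpha> t)" "t \<in> {0..1}"
      with 1 show ?thesis using cross[of t n s] by simp
    next
      fix m t assume "(p, b) = (earring_loop m t, \<gamma> m t)" "1 \<le> m" "t \<in> {0..1}"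
      with 1 show ?thesis using circles[of n s m t] by simp
    qed
  qed
  have in_R: "(?q u, ?Q u) \<in> R" if u: "u \<in> {0..1}" for u
  proof (cases "u \<le> 1 / 2")
    case True
    have "2 * u \<in> {0..1}" using u True by simp
    with True show ?thesis using R_whisker[of "2 * u"] by (simp add: joinpaths_def)
  next
    case False
    have "2 * u - 1 \<in> {0..1}" using u False by simp
    then have "(inf_concat (0, 0) earring_loop (2 * u - 1), inf_concat x \<gamma> (2 * u - 1)) \<in> R"
    proof (cases "2 * u - 1" rule: unit_interval_node_cases)
      case 1
      then show ?thesis
        using R_whisker[of 1] by (simp add: inf_concat_1 whisker_def \<alpha>'(4))
    next
      case (2 n s)
      then show ?thesis
        unfolding 2(4) inf_concat_node_add[OF 2(1,2,3)] by (intro R_loop) auto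
    qed
    then show ?thesis
      using False by (simp add: joinpaths_def earring_loop_inf_eq_inf_concat)
  qed
  have eq: "?Q s = ?Q t" if "s \<in> {0..1}" "t \<in> {0..1}" "?q s = ?q t" for s t
    using R_single[OF in_R[OF that(1)], of "?Q t"] in_R[OF that(2)] that(3) by simp
  obtain f where f: "continuous_on hawaiian_plus f" "\<And>u. u \<in> {0..1} \<Longrightarrow> f (?q u) = ?Q u"
    using continuous_factor_through_path[OF q Q(1) eq, unfolded image_q] by metis
  have fR: "f p = a" if "(p, a) \<in> R" "p \<in> hawaiian_plus" for p a
  proof -
    have "p \<in> ?q ` {0..1}" using that(2) image_q by (simp add: path_image_def)
    then obtain u where u: "u \<in> {0..1}" "p = ?q u" by (elim imageE)
    have "a = ?Q u" using R_single[OF that(1)] in_R[OF u(1)] u(2) by simp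
    then show ?thesis using f(2) u by simp
  qed
  have "f ` hawaiian_plus = path_image ?Q"
    unfolding image_q[symmetric] path_image_def image_image by (rule image_cong[OF refl f(2)])
  then have "f ` hawaiian_plus \<subseteq> X" using Q(2) by simp
  moreover have "f (whisker s) = \<alpha> s" if "s \<in> {0..1}" for s
  proof (rule fR)
    show "(whisker s, \<alpha> s) \<in> R" using R_whisker[OF that] .
    show "whisker s \<in> hawaiian_plus"
      using whisker_paths_between that by (auto simp: paths_between_def path_image_def)
  qed
  moreover have "f (earring_loop n s) = \<gamma> n s" if "n \<ge> 1" "s \<in> {0..1}" for n s
  proof (rule fR)
    show "(earring_loop n s, \<gamma> n s) \<in> R" using R_loop[OF that] .
    show "earring_loop n s \<in> hawaiian_plus"
      using earring_loop_paths_between[OF that(1)] that(2) by (auto simp: paths_between_def path_image_def)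
  qed
  ultimately show ?thesis using f(1) by (intro exI[of _ f]) simp
qed

lemma whiskered_loop_paths_between:
  assumes "p \<in> paths_between hawaiian_plus (0, 0) (0, 0)"
  shows "whisker +++ p +++ reversepath whisker
         \<in> paths_between hawaiian_plus hawaiian_plus_base hawaiian_plus_base"
  using assms whisker_paths_between by (blast intro: paths_between_join paths_between_reversepath)

lemma induced_hom_whiskered_loop:
  assumes f: "continuous_on hawaiian_plus f" "f ` hawaiian_plus \<subseteq> X"
    and p: "p \<in> paths_between hawaiian_plus (0, 0) (0, 0)"
  shows "induced_hom X f (path_class hawaiian_plus (whisker +++ p +++ reversepath whisker)) =
         path_class X ((f \<circ> whisker) +++ (f \<circ> p) +++ reversepath (f \<circ> whisker))"
  using induced_hom_path_class[OF f whiskered_loop_paths_between[OF p]]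
  by (simp add: path_compose_join path_compose_reversepath)

lemma induced_hom_C_subgroup_subset_iff:
  assumes f: "continuous_on hawaiian_plus f" "f ` hawaiian_plus \<subseteq> X" "f hawaiian_plus_base = x0"
    and H: "subgroup H (fundamental_group X x0)"
  shows "induced_hom X f ` C_subgroup \<subseteq> H \<longleftrightarrow> (\<forall>n\<ge>1. induced_hom X f (c_gen n) \<in> H)"
proof -
  have base: "hawaiian_plus_base \<in> hawaiian_plus"
    using paths_between_endpoints(1)[OF whisker_paths_between] .
  have gens: "c_gen ` {1..} \<subseteq> carrier (fundamental_group hawaiian_plus hawaiian_plus_base)"
    using earring_loop_paths_between whiskered_loop_paths_between
    by (auto simp: fundamental_group_simps c_gen_def intro: path_classI)
  show ?thesis
  proof
    assume "induced_hom X f ` C_subgroup \<subseteq> H"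
    then show "\<forall>n\<ge>1. induced_hom X f (c_gen n) \<in> H"
      unfolding C_subgroup_def by (auto intro: generate.incl)
  next
    assume "\<forall>n\<ge>1. induced_hom X f (c_gen n) \<in> H"
    then have *: "induced_hom X f ` c_gen ` {1..} \<subseteq> H" by auto
    show "induced_hom X f ` C_subgroup \<subseteq> H"
      unfolding C_subgroup_def
      by (rule group_hom.image_generate_subset[OF
            group_hom_induced_hom[OF f(1,2) base, unfolded f(3)] gens H *])
  qed
qed

section \<open>Homotopically Hausdorff spaces and closed subgroups\<close>

text \<open>Let \<open>T n\<close> be the part of the image of the infinite loop that traverses the circles from the
  \<open>n\<close>-th one on. Dropping one more circle multiplies its class on the left by an element of the
  conjugate subgroup \<open>K\<close>, so all \<open>T n\<close> lie in one right coset of \<open>K\<close>. Since every neighbourhood of the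
  base point contains some \<open>T n\<close>, the Hausdorff property forces this coset to be \<open>K\<close> itself.\<close>

lemma hausdorff_imp_test_closed:
  fixes X :: "'a::topological_space set"
  assumes H: "subgroup H (fundamental_group X x0)"
    and Haus: "homotopically_Hausdorff_rel X x0 H"
  shows "test_closed hawaiian_plus hawaiian_plus_base C_subgroup c_inf X x0 H"
  unfolding test_closed_def
proof (intro allI impI, elim conjE)
  fix f :: "real \<times> real \<Rightarrow> 'a"
  assume f: "continuous_on hawaiian_plus f" "f ` hawaiian_plus \<subseteq> X" "f hawaiian_plus_base = x0"
    and C: "induced_hom X f ` C_subgroup \<subseteq> H"
  define x where "x = f (0, 0)"
  define \<alpha> where "\<alpha> = f \<circ> whisker"
  define p where "p = f \<circ> earring_loop_inf"
  define K where "K = conj_subgroup X H \<alpha>"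
  define G where "G = fundamental_group X x"
  have \<alpha>: "\<alpha> \<in> paths_between X x0 x"
    using paths_between_compose[OF f(1,2) whisker_paths_between] f(3) by (simp add: \<alpha>_def x_def)
  have xX: "x \<in> X" using paths_between_endpoints[OF \<alpha>] by simp
  interpret G: group G unfolding G_def by (rule group_fundamental_group[OF xX])
  have K: "subgroup K G"
    unfolding K_def G_def by (rule subgroup_conj_subgroup[OF \<alpha> H])
  note in_K = path_class_in_conj_subgroup_iff[OF \<alpha> H, folded K_def]
  have loop: "f \<circ> earring_loop n \<in> paths_between X x x" if "n \<ge> 1" for n
    using paths_between_compose[OF f(1,2) earring_loop_paths_between[OF that]] by (simp add: x_def)
  have p: "p \<in> paths_between X x x"
    using paths_between_compose[OF f(1,2) earring_loop_inf_paths_between] by (simp add: p_def x_def)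
  have p': "path p" "path_image p \<subseteq> X" "p 1 = x"
    using p by (auto simp: paths_between_def pathfinish_def)
  have loop_K: "path_class X (f \<circ> earring_loop n) \<in> K" if n: "n \<ge> 1" for n
  proof -
    have "induced_hom X f (c_gen n) \<in> H"
      using C induced_hom_C_subgroup_subset_iff[OF f H] n by simp
    then show ?thesis
      unfolding in_K[OF loop[OF n]] c_gen_def \<alpha>_def
        induced_hom_whiskered_loop[OF f(1,2) earring_loop_paths_between[OF n]] .
  qed
  \<comment> \<open>Subpaths are formed in the plane and mapped by \<open>f\<close> afterwards.\<close>
  define L where "L n = subpath (node n) 1 earring_loop_inf" for n
  define T where "T n = f \<circ> L n" for n
  have inf: "path earring_loop_inf" "path_image earring_loop_inf \<subseteq> hawaiian_plus"
    "earring_loop_inf 1 = (0, 0)"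
    using earring_loop_inf_paths_between by (auto simp: paths_between_def pathfinish_def)
  have node01: "node n \<in> {0..1}" if "n \<ge> 1" for n
    using node_nonneg[OF that] node_less_1[OF that] by simp
  have L: "L n \<in> paths_between hawaiian_plus (0, 0) (0, 0)" if n: "n \<ge> 1" for n
  proof -
    have "earring_loop_inf (node n) = (0, 0)"
      using inf_concat_node_add[of n 0 "(0, 0)" earring_loop] n
      by (simp add: earring_loop_inf_eq_inf_concat earring_loop_ends)
    moreover have "path_image (L n) \<subseteq> path_image earring_loop_inf"
      unfolding L_def using node01[OF n] by (intro path_image_subpath_subset) auto
    ultimately show ?thesis
      using inf node01[OF n] unfolding paths_between_def L_def
      by (simp add: path_subpath order_trans)
  qed
  have T: "T n \<in> paths_between X x x" if "n \<ge> 1" for n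
    unfolding T_def x_def by (rule paths_between_compose[OF f(1,2) L[OF that]])
  have T_split: "path_class X (T n) = class_mult X (path_class X (f \<circ> earring_loop n)) (path_class X (T (Suc n)))"
    if n: "n \<ge> 1" for n
  proof -
    have "homotopic_paths hawaiian_plus
        (subpath (node n) (node (Suc n)) earring_loop_inf +++ L (Suc n)) (L n)"
      unfolding L_def using inf node01[OF n] node01[of "Suc n"]
      by (intro homotopic_join_subpaths) auto
    note 1 = path_class_eq[OF this]
    have "earring_loop n s = subpath (node n) (node (Suc n)) earring_loop_inf s" if "s \<in> {0..1}" for s
      unfolding earring_loop_inf_eq_inf_concat
      by (rule subpath_inf_concat[OF n that, symmetric]) (simp add: earring_loop_ends)
    then have "path_class hawaiian_plus (earring_loop n +++ L (Suc n)) =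
        path_class hawaiian_plus (subpath (node n) (node (Suc n)) earring_loop_inf +++ L (Suc n))"
      using n
      by (intro path_class_cong[OF paths_between_join[OF earring_loop_paths_between L]]
            joinpaths_eq) auto
    with 1 have "path_class hawaiian_plus (L n) = path_class hawaiian_plus (earring_loop n +++ L (Suc n))"
      by simp
    then have "path_class X (T n) = path_class X (f \<circ> (earring_loop n +++ L (Suc n)))"
      using induced_hom_path_class[OF f(1,2) L[OF n]]
        induced_hom_path_class[OF f(1,2)
          paths_between_join[OF earring_loop_paths_between[OF n] L[of "Suc n"]]]
      by (simp add: T_def)
    then show ?thesis
      using class_mult_path_class[OF loop[OF n] T[of "Suc n"]]
      by (simp add: path_compose_join T_def)
  qed
  have carr: "path_class X q \<in> carrier G" if "q \<in> paths_between X x x" for q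
    using path_classI[OF that] by (simp add: G_def fundamental_group_simps)
  have coset: "K #>\<^bsub>G\<^esub> path_class X (T n) = K #>\<^bsub>G\<^esub> path_class X p" if "n \<ge> 1" for n
    using that
  proof (induction n rule: dec_induct)
    case base
    then show ?case by (simp add: T_def L_def node_1 p_def)
  next
    case (step n)
    have n: "n \<ge> 1" using step.hyps by simp
    note loop_n = carr[OF loop[OF n]] and tail_n = carr[OF T, of "Suc n", simplified]
    have "path_class X (T n) =
        path_class X (f \<circ> earring_loop n) \<otimes>\<^bsub>G\<^esub> path_class X (T (Suc n))"
      using T_split[OF n] by (simp add: G_def fundamental_group_simps)
    then have "K #>\<^bsub>G\<^esub> path_class X (T n) =
        (K #>\<^bsub>G\<^esub> path_class X (f \<circ> earring_loop n)) #>\<^bsub>G\<^esub> path_class X (T (Suc n))"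
      by (simp only: G.coset_mult_assoc[OF subgroup.subset[OF K] loop_n tail_n])
    also have "\<dots> = K #>\<^bsub>G\<^esub> path_class X (T (Suc n))"
      by (simp only: G.coset_join2[OF loop_n K loop_K[OF n]])
    finally show ?case using step.IH by simp
  qed
  have "path_class X p \<in> K"
  proof (rule ccontr)
    assume "path_class X p \<notin> K"
    then have "path_class X p \<in> carrier (fundamental_group X x) - conj_subgroup X H \<alpha>"
      using carr[OF p] by (simp add: K_def G_def)
    then obtain U where U: "openin (top_of_set X) U" "x \<in> U"
      and no: "\<And>\<delta>. \<delta> \<in> paths_between U x x \<Longrightarrow> K #>\<^bsub>G\<^esub> path_class X p \<noteq> K #>\<^bsub>G\<^esub> path_class X \<delta>"
      using Haus[unfolded homotopically_Hausdorff_rel_def, THEN bspec, OF xX, THEN bspec, OF \<alpha>,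
          THEN bspec] unfolding K_def[symmetric] G_def[symmetric] by metis
    obtain W where W: "open W" "U = X \<inter> W" using U(1) by (auto simp: openin_open)
    obtain A where A: "open A" "1 \<in> A" "\<And>t. t \<in> {0..1} \<Longrightarrow> t \<in> A \<Longrightarrow> p t \<in> W"
      using p'(1)[unfolded path_def continuous_on_topological, rule_format, of 1 W] W U(2) p'(3)
      by auto
    obtain e where e: "e > 0" "ball 1 e \<subseteq> A" using A by (auto simp: open_contains_ball)
    obtain N :: nat where N: "1 / e < real N" using reals_Archimedean2 by blast
    have N1: "N \<ge> 1" using N e by (cases N) (auto simp: field_simps)
    then have "1 / real N < e" using N e by (simp add: field_simps)
    then have near: "t \<in> A" if "t \<in> {node N..1}" for t
      using e that by (auto simp: node_def dist_real_def subset_eq)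
    have "p t \<in> U" if "t \<in> {node N..1}" for t
    proof -
      have "t \<in> {0..1}" using that node01[OF N1] by simp
      then show ?thesis
        using A(3)[OF _ near[OF that]] p'(2) W(2) by (auto simp: path_image_def)
    qed
    moreover have "path_image (L N) = earring_loop_inf ` {node N..1}"
      using path_image_subpath[of "node N" 1 earring_loop_inf] node01[OF N1] by (simp add: L_def)
    ultimately have "path_image (T N) \<subseteq> U"
      by (auto simp: T_def path_image_compose p_def)
    then have "T N \<in> paths_between U x x"
      using T[OF N1] by (simp add: paths_between_def)
    from no[OF this] coset[OF N1] show False by simp
  qed
  then have "path_class X (\<alpha> +++ p +++ reversepath \<alpha>) \<in> H"
    using in_K[OF p] by simp
  then show "induced_hom X f c_inf \<in> H"
    unfolding c_inf_def p_def \<alpha>_def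
      induced_hom_whiskered_loop[OF f(1,2) earring_loop_inf_paths_between] .
qed

text \<open>Finite intersections of an enumerated neighbourhood base.\<close>

lemma first_countable_decreasing_nhds:
  assumes "first_countable (top_of_set X)" and x: "x \<in> X"
  shows "\<exists>U :: nat \<Rightarrow> 'a::topological_space set. (\<forall>n. openin (top_of_set X) (U n) \<and> x \<in> U n) \<and>
    (\<forall>W. open W \<longrightarrow> x \<in> W \<longrightarrow> (\<exists>N. \<forall>n\<ge>N. U n \<subseteq> W))"
proof -
  obtain B where B: "countable B" "\<And>V. V \<in> B \<Longrightarrow> openin (top_of_set X) V"
    "\<And>U. openin (top_of_set X) U \<Longrightarrow> x \<in> U \<Longrightarrow> \<exists>V\<in>B. x \<in> V \<and> V \<subseteq> U"
    using assms unfolding first_countable_def by (auto dest!: bspec[of _ _ x])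
  define B' where "B' = {V \<in> B. x \<in> V}"
  obtain V0 where "V0 \<in> B" "x \<in> V0"
    using B(3)[of X] x by (auto simp: openin_subtopology_self)
  then have B': "countable B'" "B' \<noteq> {}" using B(1) by (auto simp: B'_def)
  define U where "U n = (\<Inter>i\<le>n. from_nat_into B' i)" for n
  have elem: "from_nat_into B' i \<in> B'" for i by (rule from_nat_into[OF B'(2)])
  show ?thesis
  proof (intro exI[of _ U] conjI allI impI)
    show "openin (top_of_set X) (U n)" for n
      unfolding U_def using elem B(2) by (intro openin_INT2) (auto simp: B'_def)
    show "x \<in> U n" for n
      using elem by (auto simp: U_def B'_def)
    fix W :: "'a set" assume W: "open W" "x \<in> W"
    then obtain V where V: "V \<in> B" "x \<in> V" "V \<subseteq> X \<inter> W"
      using B(3)[of "X \<inter> W"] x by (auto simp: openin_open)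
    then obtain i where "from_nat_into B' i = V"
      using from_nat_into_surj[OF B'(1), of V] by (auto simp: B'_def)
    then have "\<forall>n\<ge>i. U n \<subseteq> W" using V by (auto simp: U_def)
    then show "\<exists>N. \<forall>n\<ge>N. U n \<subseteq> W" by blast
  qed
qed

text \<open>If the Hausdorff property fails for the coset of \<open>g\<close>, then this coset has representatives
  \<open>\<delta> n\<close> in each member of a countable neighbourhood base. Sending the \<open>n\<close>-th circle to
  \<open>\<delta>\<^sub>n \<delta>\<^sub>n\<^sub>+\<^sub>1\<^sup>-\<close> maps every generator into \<open>H\<close>, because consecutive \<open>\<delta> n\<close> differ by an element of the
  conjugate subgroup \<open>K\<close>. By closedness the infinite loop is mapped into \<open>H\<close> too; its image
  telescopes to \<open>\<delta> 1\<close>, which puts \<open>\<delta> 1\<close>, and with it \<open>g\<close>, into \<open>K\<close>.\<close>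

lemma test_closed_imp_hausdorff:
  fixes X :: "'a::topological_space set"
  assumes H: "subgroup H (fundamental_group X x0)"
    and fc: "first_countable (top_of_set X)"
    and closed: "test_closed hawaiian_plus hawaiian_plus_base C_subgroup c_inf X x0 H"
  shows "homotopically_Hausdorff_rel X x0 H"
  unfolding homotopically_Hausdorff_rel_def
proof (intro ballI, rule ccontr)
  fix x \<alpha> g
  assume x: "x \<in> X" and \<alpha>: "\<alpha> \<in> paths_between X x0 x"
    and g: "g \<in> carrier (fundamental_group X x) - conj_subgroup X H \<alpha>"
    and no_nhd: "\<not> (\<exists>U. openin (top_of_set X) U \<and> x \<in> U \<and>
          \<not> (\<exists>\<delta>\<in>paths_between U x x. conj_subgroup X H \<alpha> #>\<^bsub>fundamental_group X x\<^esub> g =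
              conj_subgroup X H \<alpha> #>\<^bsub>fundamental_group X x\<^esub> path_class X \<delta>))"
  define K where "K = conj_subgroup X H \<alpha>"
  define G where "G = fundamental_group X x"
  interpret G: group G unfolding G_def by (rule group_fundamental_group[OF x])
  have K: "subgroup K G"
    unfolding K_def G_def by (rule subgroup_conj_subgroup[OF \<alpha> H])
  note in_K = path_class_in_conj_subgroup_iff[OF \<alpha> H, folded K_def]
  have carr: "path_class X q \<in> carrier G" if "q \<in> paths_between X x x" for q
    using path_classI[OF that] by (simp add: G_def fundamental_group_simps)
  obtain U where U: "\<forall>n. openin (top_of_set X) (U n) \<and> x \<in> U n"
    "\<forall>W. open W \<longrightarrow> x \<in> W \<longrightarrow> (\<exists>N::nat. \<forall>n\<ge>N. U n \<subseteq> W)"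
    using first_countable_decreasing_nhds[OF fc x] by (elim exE conjE)
  have "\<forall>n. \<exists>\<delta>. \<delta> \<in> paths_between (U n) x x \<and> K #>\<^bsub>G\<^esub> g = K #>\<^bsub>G\<^esub> path_class X \<delta>"
  proof
    fix n
    show "\<exists>\<delta>. \<delta> \<in> paths_between (U n) x x \<and> K #>\<^bsub>G\<^esub> g = K #>\<^bsub>G\<^esub> path_class X \<delta>"
      using no_nhd U(1)[rule_format, of n] unfolding K_def[symmetric] G_def[symmetric] by blast
  qed
  from choice[OF this] obtain \<delta>
    where \<delta>': "\<forall>n. \<delta> n \<in> paths_between (U n) x x \<and> K #>\<^bsub>G\<^esub> g = K #>\<^bsub>G\<^esub> path_class X (\<delta> n)"
    by (elim exE)
  have \<delta>U: "\<delta> n \<in> paths_between (U n) x x"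
    and coset: "K #>\<^bsub>G\<^esub> g = K #>\<^bsub>G\<^esub> path_class X (\<delta> n)" for n
    using \<delta>' by auto
  have \<delta>: "\<delta> n \<in> paths_between X x x" for n
    using paths_between_mono[OF openin_imp_subset \<delta>U] U(1) by blast
  have tail: "\<exists>N. \<forall>n\<ge>N. path_image (\<delta> n) \<subseteq> W" if W: "open W" "x \<in> W" for W
  proof -
    obtain N where "\<forall>n\<ge>N. U n \<subseteq> W" using U(2) W by blast
    moreover have "path_image (\<delta> n) \<subseteq> U n" for n using \<delta>U by (simp add: paths_between_def)
    ultimately show ?thesis by (meson order_trans)
  qed
  define \<gamma> where "\<gamma> n = \<delta> n +++ reversepath (\<delta> (Suc n))" for n
  have \<gamma>: "\<gamma> n \<in> paths_between X x x" for n
    unfolding \<gamma>_def by (rule paths_between_join[OF \<delta> paths_between_reversepath[OF \<delta>]])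
  have tail\<gamma>: "\<exists>N. \<forall>n\<ge>N. path_image (\<gamma> n) \<subseteq> W" if W: "open W" "x \<in> W" for W
  proof -
    obtain N where N: "\<forall>n\<ge>N. path_image (\<delta> n) \<subseteq> W" using tail[OF W] by blast
    have "path_image (\<gamma> n) \<subseteq> path_image (\<delta> n) \<union> path_image (\<delta> (Suc n))" for n
      unfolding \<gamma>_def using path_image_join_subset[of "\<delta> n" "reversepath (\<delta> (Suc n))"] by simp
    then show ?thesis using N by (meson Un_least le_Suc_eq order_trans le_SucI)
  qed
  have \<gamma>_K: "path_class X (\<gamma> n) \<in> K" for n
  proof -
    have rev: "inv\<^bsub>G\<^esub> path_class X (\<delta> m) = path_class X (reversepath (\<delta> m))" for m
    proof (rule G.inv_equality)
      show "path_class X (reversepath (\<delta> m)) \<otimes>\<^bsub>G\<^esub> path_class X (\<delta> m) = \<one>\<^bsub>G\<^esub>"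
        using class_mult_reversepath_left[OF \<delta>] by (simp add: G_def fundamental_group_simps)
    qed (intro carr \<delta> paths_between_reversepath)+
    have "path_class X (\<delta> n) \<otimes>\<^bsub>G\<^esub> inv\<^bsub>G\<^esub> path_class X (\<delta> (Suc n)) \<in> K"
      using G.rcos_eq_iff[OF K carr[OF \<delta>] carr[OF \<delta>]] coset by metis
    then show ?thesis
      unfolding rev using class_mult_path_class[OF \<delta> paths_between_reversepath[OF \<delta>]]
      by (simp add: \<gamma>_def G_def fundamental_group_simps)
  qed
  obtain f where f: "continuous_on hawaiian_plus f" "f ` hawaiian_plus \<subseteq> X"
    and f_whisker: "\<And>s. s \<in> {0..1} \<Longrightarrow> f (whisker s) = \<alpha> s"
    and f_loop: "\<And>n s. n \<ge> 1 \<Longrightarrow> s \<in> {0..1} \<Longrightarrow> f (earring_loop n s) = \<gamma> n s"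
    using hawaiian_plus_map_exists[OF \<alpha> \<gamma> tail\<gamma>] by blast
  have \<alpha>01: "\<alpha> 0 = x0" "\<alpha> 1 = x" using \<alpha> by (auto simp: paths_between_def pathstart_def pathfinish_def)
  have f_base: "f hawaiian_plus_base = x0"
    using f_whisker[of 0] \<alpha>01 by (simp add: whisker_def hawaiian_plus_base_def)
  have f0: "f (0, 0) = x"
    using f_whisker[of 1] \<alpha>01 by (simp add: whisker_def)
  have conj_eq: "path_class X ((f \<circ> whisker) +++ (f \<circ> p) +++ reversepath (f \<circ> whisker)) =
      path_class X (\<alpha> +++ q +++ reversepath \<alpha>)"
    if "q \<in> paths_between X x x" "\<And>s. s \<in> {0..1} \<Longrightarrow> f (p s) = q s" for p q
  proof (rule path_class_cong[symmetric])
    show "\<alpha> +++ q +++ reversepath \<alpha> \<in> paths_between X x0 x0"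
      by (intro paths_between_join[OF \<alpha>] paths_between_join[OF that(1)]
            paths_between_reversepath[OF \<alpha>])
    show "(\<alpha> +++ q +++ reversepath \<alpha>) t =
        ((f \<circ> whisker) +++ (f \<circ> p) +++ reversepath (f \<circ> whisker)) t" if "t \<in> {0..1}" for t
      using that f_whisker \<open>\<And>s. s \<in> {0..1} \<Longrightarrow> f (p s) = q s\<close>
      by (intro joinpaths_eq) (auto simp: reversepath_def)
  qed
  have "induced_hom X f (c_gen n) \<in> H" if n: "n \<ge> 1" for n
  proof -
    have "path_class X ((f \<circ> whisker) +++ (f \<circ> earring_loop n) +++ reversepath (f \<circ> whisker)) =
        path_class X (\<alpha> +++ \<gamma> n +++ reversepath \<alpha>)"
      by (rule conj_eq[OF \<gamma>]) (rule f_loop[OF n])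
    moreover have "path_class X (\<alpha> +++ \<gamma> n +++ reversepath \<alpha>) \<in> H"
      using \<gamma>_K[of n] unfolding in_K[OF \<gamma>] .
    ultimately show ?thesis
      unfolding c_gen_def induced_hom_whiskered_loop[OF f earring_loop_paths_between[OF n]]
      by simp
  qed
  then have "induced_hom X f ` C_subgroup \<subseteq> H"
    unfolding induced_hom_C_subgroup_subset_iff[OF f f_base H] by simp
  then have "induced_hom X f c_inf \<in> H"
    by (intro closed[unfolded test_closed_def, rule_format] conjI f f_base)
  then have image_H: "path_class X ((f \<circ> whisker) +++ (f \<circ> earring_loop_inf) +++
      reversepath (f \<circ> whisker)) \<in> H"
    unfolding c_inf_def induced_hom_whiskered_loop[OF f earring_loop_inf_paths_between] .
  have f_inf: "f (earring_loop_inf s) = inf_concat x \<gamma> s" if "s \<in> {0..1}" for s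
  proof -
    have "f (earring_loop_inf s) = (f \<circ> inf_concat (0, 0) earring_loop) s"
      by (simp add: earring_loop_inf_eq_inf_concat)
    also have "\<dots> = inf_concat x (\<lambda>n. f \<circ> earring_loop n) s"
      by (simp only: inf_concat_compose f0)
    also have "\<dots> = inf_concat x \<gamma> s"
      by (rule inf_concat_cong[OF that]) (simp add: f_loop)
    finally show ?thesis .
  qed
  have telescope: "inf_concat x \<gamma> \<in> paths_between X x x"
    "path_class X (inf_concat x \<gamma>) = path_class X (\<delta> 1)"
    using path_class_telescope[of \<delta> X "\<lambda>n. x" x] \<delta> tail by (simp_all add: \<gamma>_def[abs_def])
  have "path_class X ((f \<circ> whisker) +++ (f \<circ> earring_loop_inf) +++ reversepath (f \<circ> whisker)) =
      path_class X (\<alpha> +++ inf_concat x \<gamma> +++ reversepath \<alpha>)"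
    by (rule conj_eq[OF telescope(1)]) (rule f_inf)
  with image_H have "path_class X (\<alpha> +++ inf_concat x \<gamma> +++ reversepath \<alpha>) \<in> H"
    by (simp only:)
  then have "path_class X (\<delta> 1) \<in> K"
    using in_K[OF telescope(1)] unfolding telescope(2) by simp
  then have "K #>\<^bsub>G\<^esub> g = K"
    using coset[of 1] G.coset_join2[OF carr[OF \<delta>] K] by simp
  then have "g \<in> K"
    using G.coset_join1[of K g] g K by (simp add: G_def)
  with g show False by (simp add: K_def)
qed

theorem theorem3p6:
  fixes X :: "'a::topological_space set"
    and x0 :: 'a
    and H :: "(real \<Rightarrow> 'a) set set"
  assumes "path_connected X"
    and "x0 \<in> X"
    and "subgroup H (fundamental_group X x0)"
  shows "(homotopically_Hausdorff_rel X x0 H \<longrightarrow>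
           test_closed hawaiian_plus hawaiian_plus_base C_subgroup c_inf X x0 H) \<and>
         (first_countable (top_of_set X) \<longrightarrow>
           test_closed hawaiian_plus hawaiian_plus_base C_subgroup c_inf X x0 H \<longrightarrow>
           homotopically_Hausdorff_rel X x0 H) \<and>
         (metrizable_space (top_of_set X) \<longrightarrow>
           test_closed hawaiian_plus hawaiian_plus_base C_subgroup c_inf X x0 H \<longrightarrow>
           homotopically_Hausdorff_rel X x0 H)"
proof (intro conjI impI)
  show "test_closed hawaiian_plus hawaiian_plus_base C_subgroup c_inf X x0 H"
    if "homotopically_Hausdorff_rel X x0 H"
    by (rule hausdorff_imp_test_closed[OF assms(3) that])
  show "homotopically_Hausdorff_rel X x0 H" if "first_countable (top_of_set X)"
    "test_closed hawaiian_plus hawaiian_plus_base C_subgroup c_inf X x0 H"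
    by (rule test_closed_imp_hausdorff[OF assms(3) that])
  show "homotopically_Hausdorff_rel X x0 H" if "metrizable_space (top_of_set X)"
    "test_closed hawaiian_plus hawaiian_plus_base C_subgroup c_inf X x0 H"
    by (rule test_closed_imp_hausdorff[OF assms(3) metrizable_imp_first_countable[OF that(1)] that(2)])
qed

end
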